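(* Let $a<t<b$, $T=b-a$, let $m\geq 1$ be an integer, let $g\in C^\infty[a,b]$, and let $f$ be a $T$-periodic function, $f\in C^\infty(\mathbb{R}_t)$ with $\mathbb{R}_t=\mathbb{R}\setminus\{t+kT: k\in\mathbb{Z}\}$, such that $$f(x)=\frac{g(x)}{(x-t)^m},\qquad x\in[a,b]\setminus\{t\}.$$ Let $I[f]$ denote the Hadamard finite part of $\int_a^b f(x)\,dx$, and for $n=1,2,\ldots$ let $$\widetilde{T}_{m,n}[f]=h\sum_{j=1}^{n-1}f(t+jh),\qquad h=\frac{T}{n}.$$ Let $\zeta$ denote the Riemann zeta function. Then the following hold. 1. For $m$ even, $m=2r$, $r=1,2,\ldots$, $$\widetilde{T}_{2r,n}[f]=I[f]+2\sum_{i=0}^{r}\frac{g^{(2i)}(t)}{(2i)!}\,\zeta(2r-2i)\,h^{-2r+2i+1}+o(h^\mu)\quad\text{as } n\to\infty,\quad \forall\,\mu>0.$$ 2. For $m$ odd, $m=2r+1$, $r=0,1,\ldots$, $$\widetilde{T}_{2r+1,n}[f]=I[f]+2\sum_{i=0}^{r}\frac{g^{(2i+1)}(t)}{(2i+1)!}\,\zeta(2r-2i)\,h^{-2r+2i+1}+o(h^\mu)\quad\text{as } n\to\infty,\quad \forall\,\mu>0.$$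
   Context: Hadamard finite part (HFP): $I[f]$ is the finite part of the divergent integral $\int_a^b f(x)\,dx$, i.e. the constant term remaining when $\int_a^{t-\epsilon}f(x)\,dx+\int_{t+\epsilon}^b f(x)\,dx$ is expanded as $\epsilon\to0+$ and the terms that diverge are discarded. Explicitly, for $f(x)=g(x)/(x-t)^m$, $$I[f]=\lim_{\epsilon\to0+}\Bigg[\int_a^{t-\epsilon}f(x)\,dx+\int_{t+\epsilon}^b f(x)\,dx-\sum_{i=0}^{m-2}\big[1+(-1)^{i-m}\big]\frac{g^{(i)}(t)}{i!}\,\frac{\epsilon^{\,i-m+1}}{m-1-i}\Bigg]$$ (the sum being empty when $m=1$, in which case $I[f]$ is the Cauchy principal value). The point $t$ and the function $f$ are fixed as $n\to\infty$. Recall $\zeta(0)=-\tfrac12$. *)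

theory Defs
  imports "HOL-Complex_Analysis.Complex_Analysis" "HOL-Library.Landau_Symbols"
begin

text \<open>The Riemann zeta function: the holomorphic continuation of the Dirichlet series to
  the complex plane without \<open>1\<close>. The continuation is unique by the identity theorem; the value
  at the pole is fixed to \<open>0\<close> only so that it is unique as a total function.\<close>

definition zeta :: "complex \<Rightarrow> complex" where
  "zeta = (THE Z. Z holomorphic_on (- {1}) \<and> Z 1 = 0 \<and>
     (\<forall>s. Re s > 1 \<longrightarrow> (\<lambda>n. 1 / of_nat (Suc n) powr s) sums Z s))"

text \<open>\<open>C\<^sup>\<infinity>\<close> on \<open>S\<close>, where \<open>D k\<close> is the \<open>k\<close>-th derivative. For \<open>S\<close> a compact interval the
  derivatives at the endpoints are one-sided; for \<open>S\<close> open, \<open>at x within S\<close> is \<open>at x\<close>.\<close>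

definition smooth_on :: "real set \<Rightarrow> (real \<Rightarrow> real) \<Rightarrow> bool" where
  "smooth_on S f \<longleftrightarrow> (\<exists>D :: nat \<Rightarrow> real \<Rightarrow> real. (\<forall>x\<in>S. D 0 x = f x) \<and>
     (\<forall>k. \<forall>x\<in>S. (D k has_real_derivative D (Suc k) x) (at x within S)))"

definition punctured_line :: "real \<Rightarrow> real \<Rightarrow> real set" where
  "punctured_line t T = UNIV - {t + of_int k * T | k :: int. True}"

text \<open>The Hadamard finite part of the integral over \<open>[a,b]\<close> of \<open>f x = g x / (x - t) ^ m\<close>, for
  \<open>a < t < b\<close> and \<open>m \<ge> 1\<close>. The subtracted sum collects the divergent terms of the expansion as
  \<open>\<epsilon>\<close> tends to \<open>0\<close>. It ranges over \<open>0 \<le> i \<le> m - 2\<close> and is empty for \<open>m = 1\<close> (Cauchy principal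
  value). As \<open>t\<close> is an interior point, \<open>(deriv ^^ i) g t\<close> only depends on \<open>g\<close> in \<open>[a,b]\<close>.\<close>

definition hadamard_fp ::
    "real \<Rightarrow> real \<Rightarrow> real \<Rightarrow> nat \<Rightarrow> (real \<Rightarrow> real) \<Rightarrow> (real \<Rightarrow> real) \<Rightarrow> real" where
  "hadamard_fp a b t m g f = Lim (at_right 0) (\<lambda>\<epsilon>.
     integral {a..t - \<epsilon>} f + integral {t + \<epsilon>..b} f
     - (\<Sum>i<m - 1. (1 + (-1) powi (int i - int m)) * ((deriv ^^ i) g t / fact i)
           * (\<epsilon> powi (int i - int m + 1) / (real m - 1 - real i))))"

definition punctured_trapezoidal :: "real \<Rightarrow> real \<Rightarrow> nat \<Rightarrow> (real \<Rightarrow> real) \<Rightarrow> real" where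
  "punctured_trapezoidal T t n f = (T / real n) * (\<Sum>j = 1..<n. f (t + real j * (T / real n)))"

end

theory Submission
  imports Defs
begin

text \<open>The sum sees the singularity of \<open>f\<close> only through its principal part at \<open>t\<close>. For every
  \<open>k \<ge> 1\<close> the doubly infinite series of \<open>(y + p) ^ (-k)\<close> over the integers \<open>p\<close> (for \<open>k = 1\<close>:
  \<open>\<pi> cot (\<pi> y)\<close>) is a periodic function, \<open>lattice_sum k\<close>, whose only singularity in a period is a
  pure pole of order \<open>k\<close>. With \<open>c k = g\<^bsup>(m-k)\<^esup>(t) / (m-k)!\<close>, the Taylor coefficients of \<open>g\<close>, the
  function \<open>u = f - \<Sum>k=1..m. c k * lattice_sum k ((x - t) / T) / T ^ k\<close> extends to a smooth
  \<open>T\<close>-periodic function on the whole line (\<open>subtract_singular_part\<close>). The claim is then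
  checked on both pieces.

  For a smooth periodic function the full trapezoidal rule is exact up to \<open>O(h ^ N)\<close> for all \<open>N\<close>
  (\<open>trapezoidal_periodic\<close>), and the finite part integral of \<open>f\<close> is the ordinary integral of \<open>u\<close>,
  because \<open>lattice_sum k\<close> has the antiderivative \<open>- lattice_sum (k - 1) / (k - 1)\<close>, so that its
  integral over a punctured period consists of the discarded divergent term and of a term which
  tends to \<open>0\<close> (\<open>hadamard_fp_eq_integral\<close>).

  For the singular piece the punctured sum is known exactly. Summing the series of
  \<open>lattice_sum k\<close> over the points \<open>j / n\<close> with \<open>0 < j < n\<close> runs through all \<open>q / n\<close> with \<open>q\<close> an
  integer not divisible by \<open>n\<close>, which gives \<open>2 \<zeta>(k) (n ^ k - 1)\<close> for even \<open>k\<close>, and \<open>0\<close> for odd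
  \<open>k\<close> by symmetry (\<open>sum_lattice_sum\<close>). The part \<open>n ^ k\<close> produces the terms with \<open>\<zeta>(k)\<close>,
  \<open>k \<ge> 2\<close>. The part \<open>-1\<close> is cancelled by the missing node: the punctured sum lacks \<open>h * u t\<close>, and
  \<open>u t\<close> is \<open>g\<^bsup>(m)\<^esup>(t) / m!\<close> minus the sum of \<open>2 c k \<zeta>(k) / T ^ k\<close> over the
  even \<open>k \<ge> 2\<close>. What remains is
  \<open>- h * g\<^bsup>(m)\<^esup>(t) / m!\<close>, which is the term with \<open>\<zeta>(0) = - 1 / 2\<close>
  (\<open>punctured_trapezoidal_eq\<close>).

  Since \<open>zeta\<close> is defined as the unique continuation of the Dirichlet series, its existence has
  to be shown before any value can be used. Both the continuation and \<open>\<zeta>(0)\<close> come from one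
  recursion (\<open>dirichlet_recursion\<close>), obtained by summing the Taylor expansion of
  \<open>(n + 1) powr (1 - s)\<close> at \<open>n\<close>.\<close>

section \<open>The zeta function at the nonnegative even integers\<close>

lemma open_half_plane: "open {s. Re s > c}"
  using open_halfspace_gt[of c "1::complex"] by simp

text \<open>On a compact disc inside the half plane \<open>Re s > c\<close> the exponents stay below \<open>- 1 - d\<close> for a
  fixed \<open>d > 0\<close>, so the series converges uniformly there by the Weierstrass M-test.\<close>

lemma powr_dominated_series:
  fixes A :: "nat \<Rightarrow> complex \<Rightarrow> complex" and M :: "complex \<Rightarrow> real"
  assumes hol: "\<And>n. A n holomorphic_on {s. Re s > c}"
    and M: "continuous_on UNIV M"
    and bound: "\<And>n s. Re s > c \<Longrightarrow> norm (A n s) \<le> M s * real (Suc n) powr (c - 1 - Re s)"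
  shows powr_dominated_series_summable: "\<And>s. Re s > c \<Longrightarrow> summable (\<lambda>n. A n s)"
    and powr_dominated_series_holomorphic: "(\<lambda>s. \<Sum>n. A n s) holomorphic_on {s. Re s > c}"
proof -
  have summ: "summable (\<lambda>n. B * real (Suc n) powr (- 1 - d))" if "d > 0" for B d :: real
  proof -
    have "summable (\<lambda>n. real n powr (- 1 - d))"
      using that by (subst summable_real_powr_iff) auto
    then show ?thesis
      by (intro summable_mult) (subst summable_Suc_iff)
  qed
  show "summable (\<lambda>n. A n s)" if "Re s > c" for s
  proof (rule summable_comparison_test')
    show "summable (\<lambda>n. M s * real (Suc n) powr (- 1 - (Re s - c)))"
      using that by (intro summ) auto
    show "norm (A n s) \<le> M s * real (Suc n) powr (- 1 - (Re s - c))" for n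
      using bound[OF that, of n] by (simp add: algebra_simps)
  qed
  show "(\<lambda>s. \<Sum>n. A n s) holomorphic_on {s. Re s > c}"
  proof (rule holomorphic_uniform_sequence)
    show "open {s. Re s > c}"
      by (rule open_half_plane)
    show "(\<lambda>s. \<Sum>n<N. A n s) holomorphic_on {s. Re s > c}" for N
      by (intro holomorphic_intros hol)
    fix x assume x: "x \<in> {s. Re s > c}"
    \<comment> \<open>half the distance to the boundary line, so that the closed disc stays inside with a margin\<close>
    define d where "d = (Re x - c) / 2"
    have d: "d > 0" using x by (simp add: d_def)
    have Re: "Re s \<ge> c + d" if "s \<in> cball x d" for s
    proof -
      have "\<bar>Re (x - s)\<bar> \<le> d"
        using that abs_Re_le_cmod[of "x - s"] by (simp add: dist_norm)
      then have "Re s \<ge> Re x - d" by (simp add: abs_le_iff)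
      then show ?thesis by (simp add: d_def field_simps)
    qed
    have "compact (M ` cball x d)"
      by (intro compact_continuous_image continuous_on_subset[OF M]) auto
    then obtain B where B: "\<And>s. s \<in> cball x d \<Longrightarrow> \<bar>M s\<bar> \<le> B"
      by (fastforce dest!: compact_imp_bounded simp: bounded_real)
    have "uniform_limit (cball x d) (\<lambda>N s. \<Sum>n<N. A n s) (\<lambda>s. \<Sum>n. A n s) sequentially"
    proof (rule Weierstrass_m_test)
      show "summable (\<lambda>n. B * real (Suc n) powr (- 1 - d))"
        by (intro summ d)
      fix n s assume s: "s \<in> cball x d"
      have "norm (A n s) \<le> M s * real (Suc n) powr (c - 1 - Re s)"
        using Re[OF s] d by (intro bound) auto
      also have "\<dots> \<le> B * real (Suc n) powr (- 1 - d)"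
        using B[OF s] Re[OF s] by (intro mult_mono powr_mono) auto
      finally show "norm (A n s) \<le> B * real (Suc n) powr (- 1 - d)" .
    qed
    moreover have "cball x d \<subseteq> {s. Re s > c}"
      using Re d by force
    ultimately show "\<exists>d. 0 < d \<and> cball x d \<subseteq> {s. Re s > c} \<and>
        uniform_limit (cball x d) (\<lambda>N s. \<Sum>n<N. A n s) (\<lambda>s. \<Sum>n. A n s) sequentially"
      using d by blast
  qed
qed

definition dirichlet :: "complex \<Rightarrow> complex" where
  "dirichlet s = (\<Sum>n. 1 / of_nat (Suc n) powr s)"

lemma norm_nat_powr: "norm (of_nat (Suc n) powr s) = real (Suc n) powr Re s"
  by (subst norm_powr_real_powr) auto

lemma dirichlet_sums: "Re s > 1 \<Longrightarrow> (\<lambda>n. 1 / of_nat (Suc n) powr s) sums dirichlet s"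
  and dirichlet_holomorphic: "dirichlet holomorphic_on {s. Re s > 1}"
proof -
  have hol: "(\<lambda>s. 1 / of_nat (Suc n) powr s) holomorphic_on {s. Re s > 1}" for n
    by (intro holomorphic_intros) auto
  have bound: "norm (1 / of_nat (Suc n) powr s) \<le> 1 * real (Suc n) powr (1 - 1 - Re s)" for n s
    by (simp add: norm_divide norm_nat_powr powr_minus_divide del: of_nat_Suc)
  show "(\<lambda>n. 1 / of_nat (Suc n) powr s) sums dirichlet s" if "Re s > 1"
    unfolding dirichlet_def
    by (intro summable_sums powr_dominated_series_summable[OF hol _ bound that]) auto
  show "dirichlet holomorphic_on {s. Re s > 1}"
    unfolding dirichlet_def[abs_def]
    by (intro powr_dominated_series_holomorphic[OF hol _ bound]) auto
qed

text \<open>The falling factorial of \<open>1 - s\<close>: the coefficient that appears when \<open>x powr (1 - s)\<close> is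
  differentiated \<open>i\<close> times.\<close>

definition falling :: "complex \<Rightarrow> nat \<Rightarrow> complex" where
  "falling s i = (\<Prod>j<i. 1 - s - of_nat j)"

lemma falling_simps [simp]: "falling s 0 = 1" "falling s (Suc i) = falling s i * (1 - s - of_nat i)"
  by (simp_all add: falling_def)

lemma falling_holomorphic [holomorphic_intros]: "(\<lambda>s. falling s i) holomorphic_on S"
  unfolding falling_def by (intro holomorphic_intros)

text \<open>The remainder of the Taylor polynomial of degree \<open>N\<close> of \<open>x powr (1 - s)\<close> at \<open>x = n + 1\<close>,
  evaluated one unit further to the right.\<close>

definition taylor_defect :: "nat \<Rightarrow> nat \<Rightarrow> complex \<Rightarrow> complex" where
  "taylor_defect N n s = of_nat (Suc (Suc n)) powr (1 - s)
     - (\<Sum>i\<le>N. falling s i / fact i * of_nat (Suc n) powr (1 - s - of_nat i))"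

text \<open>Taylor's theorem on a segment of length \<open>1\<close>: the derivative of order \<open>N + 1\<close> has size
  \<open>x powr (- N - Re s)\<close>, and this decreases in \<open>x\<close> because \<open>Re s > 1 - N\<close>. Raising \<open>N\<close> thus makes
  the series of the remainders converge, and be holomorphic, on an ever larger half plane.\<close>

lemma taylor_defect_bound:
  assumes s: "Re s > 1 - real N"
  shows "norm (taylor_defect N n s)
           \<le> norm (falling s (Suc N)) / fact N * real (Suc n) powr ((1 - real N) - 1 - Re s)"
proof -
  define w z :: complex where "w = of_nat (Suc n)" and "z = of_nat (Suc (Suc n))"
  define F where "F = (\<lambda>i x. falling s i * x powr (1 - s - of_nat i))"
  let ?S = "closed_segment w z"
  have S: "x = of_real (Re x) \<and> Re x \<ge> real (Suc n)" if "x \<in> ?S" for x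
  proof -
    have wz: "w = of_real (real (Suc n))" "z = of_real (real (Suc (Suc n)))"
      by (simp_all add: w_def z_def)
    from that obtain y where "x = of_real y" "y \<in> closed_segment (real (Suc n)) (real (Suc (Suc n)))"
      unfolding wz closed_segment_of_real by blast
    then show ?thesis by (simp add: closed_segment_eq_real_ivl split: if_splits)
  qed
  have B: "norm (F (Suc N) x) \<le> norm (falling s (Suc N)) * real (Suc n) powr (- real N - Re s)"
    if "x \<in> ?S" for x
  proof -
    have "norm (x powr (1 - s - of_nat (Suc N))) = Re x powr (- real N - Re s)"
      using S[OF that] by (subst norm_powr_real_powr) (auto simp: complex_is_Real_iff complex_eq_iff minus_diff_commute)
    also have "\<dots> \<le> real (Suc n) powr (- real N - Re s)"
      using S[OF that] s by (intro powr_mono2') auto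
    finally show ?thesis
      unfolding F_def norm_mult by (intro mult_left_mono) auto
  qed
  have deriv: "(F i has_field_derivative F (Suc i) x) (at x within ?S)" if "x \<in> ?S" for x i
  proof -
    have "x \<notin> \<real>\<^sub>\<le>\<^sub>0"
      using S[OF that] by (auto simp: complex_nonpos_Reals_iff)
    then show ?thesis
      unfolding F_def
      by (auto intro!: derivative_eq_intros simp: algebra_simps)
  qed
  have "norm (F 0 z - (\<Sum>i\<le>N. F i w * (z - w) ^ i / fact i))
      \<le> (norm (falling s (Suc N)) * real (Suc n) powr (- real N - Re s)) * norm (z - w) ^ Suc N / fact N"
    by (rule field_Taylor[OF convex_closed_segment deriv B]) auto
  moreover have "z - w = 1"
    by (simp add: w_def z_def)
  moreover have "F 0 z - (\<Sum>i\<le>N. F i w * 1 ^ i / fact i) = taylor_defect N n s"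
    by (simp add: F_def taylor_defect_def w_def z_def)
  ultimately show ?thesis
    by (simp add: field_simps)
qed

definition defect_sum :: "nat \<Rightarrow> complex \<Rightarrow> complex" where
  "defect_sum N s = (\<Sum>n. taylor_defect N n s)"

lemma defect_sum_sums: "Re s > 1 - real N \<Longrightarrow> (\<lambda>n. taylor_defect N n s) sums defect_sum N s"
  and defect_sum_holomorphic: "defect_sum N holomorphic_on {s. Re s > 1 - real N}"
proof -
  have hol: "taylor_defect N n holomorphic_on {s. Re s > 1 - real N}" for n
    unfolding taylor_defect_def[abs_def] by (intro holomorphic_intros) auto
  have M: "continuous_on UNIV (\<lambda>s. norm (falling s (Suc N)) / fact N)"
    by (intro continuous_intros holomorphic_on_imp_continuous_on holomorphic_intros) auto
  show "(\<lambda>n. taylor_defect N n s) sums defect_sum N s" if "Re s > 1 - real N"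
    unfolding defect_sum_def
    by (intro summable_sums powr_dominated_series_summable[OF hol M taylor_defect_bound that])
  show "defect_sum N holomorphic_on {s. Re s > 1 - real N}"
    unfolding defect_sum_def[abs_def]
    by (intro powr_dominated_series_holomorphic[OF hol M taylor_defect_bound])
qed

text \<open>Sum \<open>taylor_defect (K + 1) n s\<close> over \<open>n\<close>. The value at \<open>n + 2\<close> minus the Taylor term of
  degree \<open>0\<close> telescopes to \<open>- 1\<close>, and the term of degree \<open>k + 1\<close> sums to a multiple of the Dirichlet series at \<open>s + k\<close>. The factor
  \<open>1 - s - k\<close> of the falling factorial cancels the pole of that series, so the recursion is stated for
  \<open>(s - 1) \<zeta>(s)\<close>, which has no pole. The right-hand side involves arguments
  further to the right only, apart from the defect.\<close>

lemma dirichlet_recursion: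
  assumes s: "Re s > 1"
  shows "(s - 1) * dirichlet s = 1 + defect_sum (Suc K) s
           - (\<Sum>k\<in>{1..K}. falling s k / fact (Suc k) * ((s + of_nat k - 1) * dirichlet (s + of_nat k)))"
proof -
  let ?x = "\<lambda>n. of_nat (Suc n) :: complex"
  have "(\<lambda>n. ?x n powr (1 - s)) \<longlonglongrightarrow> 0"
  proof (rule tendsto_norm_zero_cancel)
    have "(\<lambda>n. real (Suc n) powr (1 - Re s)) \<longlonglongrightarrow> 0"
      using s by (intro tendsto_neg_powr filterlim_compose[OF filterlim_real_sequentially filterlim_Suc]) auto
    then show "(\<lambda>n. norm (?x n powr (1 - s))) \<longlonglongrightarrow> 0"
      by (simp add: norm_nat_powr del: of_nat_Suc)
  qed
  from telescope_sums[OF this]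
  have tel: "(\<lambda>n. ?x (Suc n) powr (1 - s) - ?x n powr (1 - s)) sums (- 1)"
    by simp
  have summand: "(\<lambda>n. falling s (Suc k) / fact (Suc k) * ?x n powr (1 - s - of_nat (Suc k)))
      sums (falling s (Suc k) / fact (Suc k) * dirichlet (s + of_nat k))" for k
  proof (rule sums_mult)
    have "(\<lambda>n. 1 / ?x n powr (s + of_nat k)) sums dirichlet (s + of_nat k)"
      using s by (intro dirichlet_sums) auto
    moreover have "?x n powr (1 - s - of_nat (Suc k)) = 1 / ?x n powr (s + of_nat k)" for n
      by (subst powr_minus_divide[symmetric]) simp
    ultimately show "(\<lambda>n. ?x n powr (1 - s - of_nat (Suc k))) sums dirichlet (s + of_nat k)"
      by simp
  qed
  have "(\<lambda>n. (?x (Suc n) powr (1 - s) - ?x n powr (1 - s))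
          - (\<Sum>k\<in>{..K}. falling s (Suc k) / fact (Suc k) * ?x n powr (1 - s - of_nat (Suc k))))
      sums (- 1 - (\<Sum>k\<in>{..K}. falling s (Suc k) / fact (Suc k) * dirichlet (s + of_nat k)))"
    by (intro sums_diff tel sums_sum summand)
  also have "(\<lambda>n. (?x (Suc n) powr (1 - s) - ?x n powr (1 - s))
          - (\<Sum>k\<in>{..K}. falling s (Suc k) / fact (Suc k) * ?x n powr (1 - s - of_nat (Suc k))))
      = (\<lambda>n. taylor_defect (Suc K) n s)"
    unfolding taylor_defect_def sum.atMost_Suc_shift by (simp add: fun_eq_iff del: of_nat_Suc falling_simps(2))
  finally have defect: "defect_sum (Suc K) s
      = - 1 - (\<Sum>k\<in>{..K}. falling s (Suc k) / fact (Suc k) * dirichlet (s + of_nat k))"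
    using defect_sum_sums[of "Suc K" s] s by (auto dest: sums_unique2)
  have "(\<Sum>k\<in>{..K}. falling s (Suc k) / fact (Suc k) * dirichlet (s + of_nat k))
      = (\<Sum>k\<in>{..K}. - (falling s k / fact (Suc k) * ((s + of_nat k - 1) * dirichlet (s + of_nat k))))"
  proof (rule sum.cong)
    fix k
    define q where "q = s + of_nat k - 1"
    have q: "1 - s - of_nat k = - q" by (simp add: q_def)
    show "falling s (Suc k) / fact (Suc k) * dirichlet (s + of_nat k)
        = - (falling s k / fact (Suc k) * ((s + of_nat k - 1) * dirichlet (s + of_nat k)))"
      unfolding falling_simps(2) q q_def[symmetric] by simp
  qed simp
  also have "\<dots> = - ((s - 1) * dirichlet s)
        - (\<Sum>k\<in>{1..K}. falling s k / fact (Suc k) * ((s + of_nat k - 1) * dirichlet (s + of_nat k)))"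
  proof -
    have "{..K} = insert 0 {1..K}" by auto
    then show ?thesis by (simp add: sum_negf)
  qed
  finally show ?thesis
    unfolding defect by simp
qed

text \<open>The identity theorem, for functions which agree where the Dirichlet series converges.\<close>

lemma half_plane_eqI:
  assumes f: "f holomorphic_on {s. Re s > c}" and g: "g holomorphic_on {s. Re s > c}"
    and eq: "\<And>s. Re s > 1 \<Longrightarrow> f s = g s" and c: "c \<le> 1" and z: "Re z > c"
  shows "f z = g z"
proof (rule analytic_continuation_open[OF open_half_plane open_half_plane _ _ _ f g])
  have "2 \<in> {s. Re s > 1}" by simp
  then show "{s. Re s > 1} \<noteq> {}" by blast
  show "connected {s. Re s > c}"
    by (intro convex_connected convex_halfspace_Re_gt)
  show "{s. Re s > 1} \<subseteq> {s. Re s > c}" using c by auto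
  show "f s = g s" if "s \<in> {s. Re s > 1}" for s using eq that by simp
  show "z \<in> {s. Re s > c}" using z by simp
qed

text \<open>Each use of the recursion moves the boundary of the half plane one unit to the left.\<close>

lemma continuation_to_half_plane:
  "\<exists>\<Xi>. \<Xi> holomorphic_on {s. Re s > 1 - real K} \<and> (\<forall>s. Re s > 1 \<longrightarrow> \<Xi> s = (s - 1) * dirichlet s)"
proof (induction K)
  case 0
  show ?case
    by (intro exI[of _ "\<lambda>s. (s - 1) * dirichlet s"]) (auto intro!: holomorphic_intros dirichlet_holomorphic)
next
  case (Suc K)
  then obtain \<Xi> where hol: "\<Xi> holomorphic_on {s. Re s > 1 - real K}"
    and eq: "\<And>s. Re s > 1 \<Longrightarrow> \<Xi> s = (s - 1) * dirichlet s"
    by blast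
  define \<Xi>' where "\<Xi>' = (\<lambda>s. 1 + defect_sum (Suc K) s
      - (\<Sum>k\<in>{1..K}. falling s k / fact (Suc k) * \<Xi> (s + of_nat k)))"
  have "(\<lambda>s. \<Xi> (s + of_nat k)) holomorphic_on {s. Re s > 1 - real (Suc K)}" if "k \<in> {1..K}" for k
    using holomorphic_on_compose_gen[of "\<lambda>s. s + of_nat k" "{s. Re s > 1 - real (Suc K)}" \<Xi>, OF _ hol] that
    by (force simp: o_def intro: holomorphic_intros)
  then have "\<Xi>' holomorphic_on {s. Re s > 1 - real (Suc K)}"
    unfolding \<Xi>'_def by (intro holomorphic_intros defect_sum_holomorphic) auto
  moreover have "\<Xi>' s = (s - 1) * dirichlet s" if "Re s > 1" for s
    using that by (simp add: \<Xi>'_def dirichlet_recursion[of s K] eq)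
  ultimately show ?case by blast
qed

text \<open>The continuations to the half planes agree wherever two of them are defined, so they glue.\<close>

lemma entire_continuation:
  obtains \<xi> where "\<xi> holomorphic_on UNIV" "\<And>s. Re s > 1 \<Longrightarrow> \<xi> s = (s - 1) * dirichlet s"
proof -
  obtain \<Xi> where hol: "\<And>K. \<Xi> K holomorphic_on {s. Re s > 1 - real K}"
    and eq: "\<And>K s. Re s > 1 \<Longrightarrow> \<Xi> K s = (s - 1) * dirichlet s"
    using continuation_to_half_plane by metis
  define \<xi> where "\<xi> = (\<lambda>s. \<Xi> (nat \<lceil>2 - Re s\<rceil>) s)"
  have \<xi>: "\<xi> s = \<Xi> K s" if "Re s > 1 - real K" for s K
  proof -
    define L where "L = nat \<lceil>2 - Re s\<rceil>"
    define c where "c = max (1 - real K) (1 - real L)"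
    have "real L \<ge> 2 - Re s" unfolding L_def by linarith
    then have "Re s > c" using that by (simp add: c_def)
    then have "\<Xi> L s = \<Xi> K s"
    proof (rule half_plane_eqI[rotated -1])
      show "\<Xi> L holomorphic_on {s. Re s > c}" "\<Xi> K holomorphic_on {s. Re s > c}"
        by (rule holomorphic_on_subset[OF hol], simp add: c_def subset_iff)+
    qed (simp_all add: eq c_def)
    then show ?thesis by (simp add: \<xi>_def L_def)
  qed
  have "\<xi> holomorphic_on (\<Union>K. {s. Re s > 1 - real K})"
    by (intro holomorphic_on_UN_open open_half_plane holomorphic_transform[OF hol]) (auto simp: \<xi>)
  moreover have "(\<Union>K. {s. Re s > 1 - real K}) = UNIV"
  proof -
    have "\<exists>K. Re s > 1 - real K" for s
      using reals_Archimedean2[of "1 - Re s"] by (auto simp: algebra_simps)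
    then show ?thesis by blast
  qed
  moreover have "\<xi> s = (s - 1) * dirichlet s" if "Re s > 1" for s
    using \<xi>[of 0 s] eq that by simp
  ultimately show ?thesis using that by simp
qed

lemma zeta_eqI:
  assumes "Z holomorphic_on (- {1})" "Z 1 = 0"
    and "\<And>s. Re s > 1 \<Longrightarrow> (\<lambda>n. 1 / of_nat (Suc n) powr s) sums Z s"
  shows "zeta = Z"
  unfolding zeta_def
proof (rule the_equality)
  show "Z holomorphic_on (- {1}) \<and> Z 1 = 0 \<and> (\<forall>s. Re s > 1 \<longrightarrow> (\<lambda>n. 1 / of_nat (Suc n) powr s) sums Z s)"
    using assms by blast
  fix W assume W: "W holomorphic_on (- {1}) \<and> W 1 = 0 \<and> (\<forall>s. Re s > 1 \<longrightarrow> (\<lambda>n. 1 / of_nat (Suc n) powr s) sums W s)"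
  have "W s = Z s" if "s \<noteq> 1" for s
  proof (rule analytic_continuation_open[of "{s. Re s > 1}" "- {1}" W Z])
    have "2 \<in> {s. Re s > 1}" by simp
    then show "{s. Re s > 1} \<noteq> {}" by blast
    show "connected (- {1 :: complex})"
      by (intro connected_punctured_universe) auto
    show "W s = Z s" if "s \<in> {s. Re s > 1}" for s
      using that W assms(3) sums_unique2 by blast
  qed (use W assms that in \<open>auto intro: open_half_plane\<close>)
  then show "W = Z" using W assms(2) by (metis ext)
qed

lemma zeta_characterization:
  obtains \<xi> where "\<xi> holomorphic_on UNIV" "\<And>s. Re s > 1 \<Longrightarrow> \<xi> s = (s - 1) * dirichlet s"
    "\<And>s. s \<noteq> 1 \<Longrightarrow> zeta s = \<xi> s / (s - 1)"
proof -
  obtain \<xi> where hol: "\<xi> holomorphic_on UNIV"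
    and eq: "\<And>s. Re s > 1 \<Longrightarrow> \<xi> s = (s - 1) * dirichlet s"
    by (rule entire_continuation) blast
  define Z where "Z = (\<lambda>s. if s = 1 then 0 else \<xi> s / (s - 1))"
  have "zeta = Z"
  proof (rule zeta_eqI)
    have "(\<lambda>s. \<xi> s / (s - 1)) holomorphic_on - {1}"
      by (intro holomorphic_intros holomorphic_on_subset[OF hol]) auto
    then show "Z holomorphic_on - {1}"
      by (rule holomorphic_transform) (auto simp: Z_def)
    show "(\<lambda>n. 1 / of_nat (Suc n) powr s) sums Z s" if "Re s > 1" for s
    proof -
      have "s \<noteq> 1" using that by auto
      then have "Z s = dirichlet s" using eq[OF that] by (simp add: Z_def)
      then show ?thesis using dirichlet_sums[OF that] by simp
    qed
  qed (simp add: Z_def)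
  then have "zeta s = \<xi> s / (s - 1)" if "s \<noteq> 1" for s
    unfolding \<open>zeta = Z\<close> Z_def using that by simp
  with hol eq show ?thesis by (rule that)
qed

lemma zeta_sums:
  assumes "Re s > 1"
  shows "(\<lambda>n. 1 / of_nat (Suc n) powr s) sums zeta s"
proof -
  obtain \<xi> where "\<xi> s = (s - 1) * dirichlet s" "s \<noteq> 1 \<Longrightarrow> zeta s = \<xi> s / (s - 1)"
    by (rule zeta_characterization) (use assms in blast)
  moreover have "s \<noteq> 1" using assms by auto
  ultimately show ?thesis using dirichlet_sums[OF assms] by simp
qed

text \<open>By the identity theorem the recursion with \<open>K = 1\<close> holds for the entire function
  \<open>\<xi> s = (s - 1) \<zeta>(s)\<close> on \<open>Re s > - 1\<close>. At \<open>s = 0\<close> and \<open>s = 1\<close> the function \<open>x powr (1 - s)\<close> is a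
  polynomial, so the defect vanishes; hence \<open>\<xi> 1 = 1\<close> and \<open>\<xi> 0 = 1 - \<xi> 1 / 2 = 1 / 2\<close>.\<close>

lemma zeta_0: "zeta 0 = - 1 / 2"
proof -
  obtain \<xi> where hol: "\<xi> holomorphic_on UNIV"
    and eq: "\<And>s. Re s > 1 \<Longrightarrow> \<xi> s = (s - 1) * dirichlet s"
    and zeta: "\<And>s. s \<noteq> 1 \<Longrightarrow> zeta s = \<xi> s / (s - 1)"
    by (rule zeta_characterization) blast
  have rec: "\<xi> s = 1 + defect_sum 2 s - (1 - s) / 2 * \<xi> (s + 1)" if "Re s > - 1" for s
  proof (rule half_plane_eqI[of \<xi> "-1" "\<lambda>s. 1 + defect_sum 2 s - (1 - s) / 2 * \<xi> (s + 1)"])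
    have "(\<lambda>s. \<xi> (s + 1)) holomorphic_on {s. Re s > - 1}"
      using holomorphic_on_compose_gen[of "\<lambda>s. s + 1" "{s. Re s > - 1}" \<xi>, OF _ hol]
      by (force simp: o_def intro: holomorphic_intros)
    then show "(\<lambda>s. 1 + defect_sum 2 s - (1 - s) / 2 * \<xi> (s + 1)) holomorphic_on {s. Re s > - 1}"
      using defect_sum_holomorphic[of 2] by (intro holomorphic_intros) auto
    show "\<xi> s = 1 + defect_sum 2 s - (1 - s) / 2 * \<xi> (s + 1)" if "Re s > 1" for s
      using dirichlet_recursion[OF that, of 1] that eq[of s] eq[of "s + 1"]
      by (simp add: numeral_2_eq_2)
  qed (use that hol in \<open>auto intro: holomorphic_on_subset\<close>)
  have nz: "1 + of_nat n \<noteq> (0 :: complex)" "2 + of_nat n \<noteq> (0 :: complex)" for n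
    using of_nat_neq_0[of n, where ?'a = complex] of_nat_neq_0[of "Suc n", where ?'a = complex] by simp_all
  have "defect_sum 2 0 = 0" "defect_sum 2 1 = 0"
    using nz by (simp_all add: defect_sum_def taylor_defect_def numeral_2_eq_2)
  then show ?thesis
    using rec[of 0] rec[of 1] zeta[of 0] by simp
qed

lemma zeta_nat_sums:
  assumes "k \<ge> 2"
  shows "(\<lambda>n. 1 / real (Suc n) ^ k) sums Re (zeta (of_nat k))"
proof -
  have "(\<lambda>n. 1 / of_nat (Suc n) powr (of_nat k :: complex)) sums zeta (of_nat k)"
    using assms by (intro zeta_sums) auto
  then have "(\<lambda>n. Re (1 / of_nat (Suc n) powr (of_nat k :: complex))) sums Re (zeta (of_nat k))"
    by (rule sums_Re)
  moreover have "1 / of_nat (Suc n) powr (of_nat k :: complex) = of_real (1 / real (Suc n) ^ k)" for n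
    by (subst powr_complexpow) (auto simp del: of_nat_Suc)
  ultimately show ?thesis by (simp del: of_nat_Suc)
qed

section \<open>Smooth functions and division by powers of a linear factor\<close>

text \<open>A chain of successive derivatives, the witness in the definition of smoothness. On sets which are not
  open it is more convenient than iterating \<open>deriv\<close>, which is the two-sided derivative.\<close>

definition deriv_family :: "real set \<Rightarrow> (nat \<Rightarrow> real \<Rightarrow> real) \<Rightarrow> bool" where
  "deriv_family S D \<longleftrightarrow> (\<forall>k. \<forall>x\<in>S. (D k has_real_derivative D (Suc k) x) (at x within S))"

lemma deriv_familyD: "deriv_family S D \<Longrightarrow> x \<in> S \<Longrightarrow> (D k has_real_derivative D (Suc k) x) (at x within S)"
  by (simp add: deriv_family_def)

lemma smooth_on_altdef: "smooth_on S f \<longleftrightarrow> (\<exists>D. (\<forall>x\<in>S. D 0 x = f x) \<and> deriv_family S D)"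
  by (simp add: smooth_on_def deriv_family_def)

lemma deriv_family_continuous_on: "deriv_family S D \<Longrightarrow> continuous_on S (D k)"
  unfolding continuous_on_eq_continuous_within
  by (blast intro: DERIV_continuous dest: deriv_familyD)

lemma smooth_on_continuous_on: "smooth_on S f \<Longrightarrow> continuous_on S f"
  unfolding smooth_on_altdef by (metis continuous_on_cong deriv_family_continuous_on)

lemma deriv_family_subset: "deriv_family S D \<Longrightarrow> S' \<subseteq> S \<Longrightarrow> deriv_family S' D"
  unfolding deriv_family_def by (meson DERIV_subset subsetD)

lemma smooth_on_subset: "smooth_on S f \<Longrightarrow> S' \<subseteq> S \<Longrightarrow> smooth_on S' f"
  unfolding smooth_on_altdef using deriv_family_subset[of S _ S'] by blast

lemma smooth_on_cong: "smooth_on S f \<Longrightarrow> (\<And>x. x \<in> S \<Longrightarrow> f x = g x) \<Longrightarrow> smooth_on S g"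
  unfolding smooth_on_altdef by metis

lemma deriv_family_eq_higher_deriv:
  assumes "open S" "deriv_family S D" "\<And>x. x \<in> S \<Longrightarrow> D 0 x = f x" "x \<in> S"
  shows "D k x = (deriv ^^ k) f x"
  using assms(4)
proof (induction k arbitrary: x)
  case 0
  then show ?case using assms(3) by simp
next
  case (Suc k)
  have "(D k has_real_derivative D (Suc k) x) (at x)"
    using deriv_familyD[OF assms(2) Suc.prems] by (simp add: at_within_open[OF Suc.prems assms(1)])
  then have "((deriv ^^ k) f has_real_derivative D (Suc k) x) (at x)"
    by (rule has_field_derivative_transform_within_open[OF _ assms(1) Suc.prems]) (rule Suc.IH)
  then show ?case by (simp add: DERIV_imp_deriv)
qed

lemma smooth_on_open_iff:
  assumes "open S"
  shows "smooth_on S f \<longleftrightarrow>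
    (\<forall>k. \<forall>x\<in>S. ((deriv ^^ k) f has_real_derivative (deriv ^^ Suc k) f x) (at x))"
proof
  assume "smooth_on S f"
  then obtain D where D: "\<And>x. x \<in> S \<Longrightarrow> D 0 x = f x" "deriv_family S D"
    by (auto simp: smooth_on_altdef)
  show "\<forall>k. \<forall>x\<in>S. ((deriv ^^ k) f has_real_derivative (deriv ^^ Suc k) f x) (at x)"
  proof (intro allI ballI)
    fix k x assume x: "x \<in> S"
    have eq: "D k x = (deriv ^^ k) f x" if "x \<in> S" for k x
      using deriv_family_eq_higher_deriv[OF assms D(2) D(1)] that by blast
    have "(D k has_real_derivative D (Suc k) x) (at x)"
      using deriv_familyD[OF D(2) x] by (simp add: at_within_open[OF x assms])
    then have "((deriv ^^ k) f has_real_derivative D (Suc k) x) (at x)"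
      by (rule has_field_derivative_transform_within_open[OF _ assms x]) (rule eq)
    then show "((deriv ^^ k) f has_real_derivative (deriv ^^ Suc k) f x) (at x)"
      unfolding eq[OF x] .
  qed
next
  assume "\<forall>k. \<forall>x\<in>S. ((deriv ^^ k) f has_real_derivative (deriv ^^ Suc k) f x) (at x)"
  then show "smooth_on S f"
    unfolding smooth_on_altdef deriv_family_def
    by (intro exI[of _ "\<lambda>k. (deriv ^^ k) f"]) (auto intro: has_field_derivative_at_within)
qed

text \<open>On open sets the witnesses are the canonical \<open>(deriv ^^ k) f\<close>, so local smoothness needs no
  patching of chosen derivative families.\<close>

lemma smooth_on_local:
  assumes "\<And>x. x \<in> S \<Longrightarrow> \<exists>U. open U \<and> x \<in> U \<and> smooth_on U f" and "open S"
  shows "smooth_on S f"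
  unfolding smooth_on_open_iff[OF assms(2)]
proof (intro allI ballI)
  fix k x assume "x \<in> S"
  then obtain U where "open U" "x \<in> U" "smooth_on U f" using assms(1) by blast
  then show "((deriv ^^ k) f has_real_derivative (deriv ^^ Suc k) f x) (at x)"
    using smooth_on_open_iff by blast
qed

lemma smooth_on_zero: "smooth_on S (\<lambda>x. 0)"
  unfolding smooth_on_def by (intro exI[of _ "\<lambda>k x. 0"]) auto

lemma smooth_on_add:
  assumes "smooth_on S f" "smooth_on S g"
  shows "smooth_on S (\<lambda>x. f x + g x)"
proof -
  obtain D E where "\<forall>x\<in>S. D 0 x = f x" "deriv_family S D" "\<forall>x\<in>S. E 0 x = g x" "deriv_family S E"
    using assms by (auto simp: smooth_on_altdef)
  then show ?thesis
    unfolding smooth_on_altdef deriv_family_def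
    by (intro exI[of _ "\<lambda>k x. D k x + E k x"]) (auto intro!: derivative_eq_intros)
qed

lemma smooth_on_cmult:
  assumes "smooth_on S f"
  shows "smooth_on S (\<lambda>x. c * f x)"
proof -
  obtain D where "\<forall>x\<in>S. D 0 x = f x" "deriv_family S D"
    using assms by (auto simp: smooth_on_altdef)
  then show ?thesis
    unfolding smooth_on_altdef deriv_family_def
    by (intro exI[of _ "\<lambda>k x. c * D k x"]) (auto intro!: derivative_eq_intros)
qed

lemma smooth_on_diff:
  assumes "smooth_on S f" "smooth_on S g"
  shows "smooth_on S (\<lambda>x. f x - g x)"
  using smooth_on_add[OF assms(1) smooth_on_cmult[OF assms(2), of "-1"]] by simp

lemma smooth_on_sum:
  assumes "\<And>i. i \<in> I \<Longrightarrow> smooth_on S (f i)"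
  shows "smooth_on S (\<lambda>x. \<Sum>i\<in>I. f i x)"
  using assms by (induction I rule: infinite_finite_induct) (auto intro: smooth_on_zero smooth_on_add)

lemma smooth_on_affine:
  assumes "smooth_on S f" "\<And>x. x \<in> S' \<Longrightarrow> c * x + d \<in> S"
  shows "smooth_on S' (\<lambda>x. f (c * x + d))"
proof -
  obtain D where D: "\<forall>x\<in>S. D 0 x = f x" "deriv_family S D"
    using assms by (auto simp: smooth_on_altdef)
  have "((\<lambda>x. c ^ k * D k (c * x + d)) has_real_derivative c ^ Suc k * D (Suc k) (c * x + d)) (at x within S')"
    if "x \<in> S'" for k x
  proof -
    have "(\<lambda>x. c * x + d) ` S' \<subseteq> S" using assms(2) by blast
    then have "(D k has_real_derivative D (Suc k) (c * x + d)) (at (c * x + d) within (\<lambda>x. c * x + d) ` S')"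
      by (rule DERIV_subset[OF deriv_familyD[OF D(2) assms(2)[OF that]]])
    moreover have "((\<lambda>x. c * x + d) has_real_derivative c) (at x within S')"
      by (auto intro!: derivative_eq_intros)
    ultimately have "((\<lambda>x. D k (c * x + d)) has_real_derivative D (Suc k) (c * x + d) * c) (at x within S')"
      using DERIV_image_chain[of "D k" _ "\<lambda>x. c * x + d"] by (simp add: o_def)
    from DERIV_cmult[OF this, of "c ^ k"] show ?thesis by (simp add: mult_ac)
  qed
  then show ?thesis
    unfolding smooth_on_altdef deriv_family_def
    using D(1) assms(2) by (intro exI[of _ "\<lambda>k x. c ^ k * D k (c * x + d)"]) simp
qed

text \<open>Hadamard's lemma: \<open>(D 0 x - D 0 t) / (x - t)\<close> is the mean of the derivative over the segment from
  \<open>t\<close> to \<open>x\<close>, and in this form it can be differentiated under the integral sign any number of times,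
  also at \<open>x = t\<close>.\<close>

lemma hadamard_division:
  assumes t: "t \<in> {a..b}" and D: "deriv_family {a..b} D"
  obtains E where "deriv_family {a..b} E"
    "\<And>x. x \<in> {a..b} \<Longrightarrow> D 0 x = D 0 t + (x - t) * E 0 x"
    "\<And>k. E k t = D (Suc k) t / real (Suc k)"
proof
  define E where "E = (\<lambda>k x. integral {0..1} (\<lambda>s. s ^ k * D (Suc k) (t + s * (x - t))))"
  have seg: "t + s * (x - t) \<in> {a..b}" if "x \<in> {a..b}" "s \<in> {0..1}" for x s
  proof -
    have "(1 - s) *\<^sub>R t + s *\<^sub>R x \<in> {a..b}"
      using that t by (intro convexD) auto
    then show ?thesis by (simp add: algebra_simps)
  qed
  have deriv: "((\<lambda>z. D k (\<alpha> z)) has_real_derivative D (Suc k) (\<alpha> x) * c) (at x within U)"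
    if "x \<in> U" "\<And>z. z \<in> U \<Longrightarrow> \<alpha> z \<in> {a..b}" "(\<alpha> has_real_derivative c) (at x within U)"
    for \<alpha> c x U k
  proof -
    have "\<alpha> ` U \<subseteq> {a..b}" using that by blast
    then have "(D k has_real_derivative D (Suc k) (\<alpha> x)) (at (\<alpha> x) within \<alpha> ` U)"
      by (rule DERIV_subset[OF deriv_familyD[OF D that(2)[OF that(1)]]])
    then show ?thesis
      using DERIV_image_chain[OF _ that(3)] by (simp add: o_def)
  qed
  show "deriv_family {a..b} E"
    unfolding deriv_family_def
  proof (intro allI ballI)
    fix k x assume x: "x \<in> {a..b}"
    show "(E k has_real_derivative E (Suc k) x) (at x within {a..b})"
      unfolding E_def box_real(2)[symmetric]
    proof (rule leibniz_rule_field_derivative)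
      fix z s :: real assume z: "z \<in> cbox a b" and s: "s \<in> cbox 0 1"
      have "((\<lambda>z. D (Suc k) (t + s * (z - t))) has_real_derivative
          D (Suc (Suc k)) (t + s * (z - t)) * s) (at z within cbox a b)"
        using z s by (intro deriv) (auto intro!: derivative_eq_intros seg[simplified])
      from DERIV_cmult[OF this, of "s ^ k"]
      show "((\<lambda>z. s ^ k * D (Suc k) (t + s * (z - t))) has_real_derivative
          s ^ Suc k * D (Suc (Suc k)) (t + s * (z - t))) (at z within cbox a b)"
        by (simp add: mult_ac)
    next
      fix z assume z: "z \<in> cbox a b"
      show "(\<lambda>s. s ^ k * D (Suc k) (t + s * (z - t))) integrable_on cbox 0 1"
        using z seg by (intro integrable_continuous continuous_intros
            continuous_on_compose2[OF deriv_family_continuous_on[OF D]]) (auto simp del: atLeastAtMost_iff)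
    next
      show "continuous_on (cbox a b \<times> cbox 0 1) (\<lambda>(z, s). s ^ Suc k * D (Suc (Suc k)) (t + s * (z - t)))"
        unfolding split_beta using seg
        by (intro continuous_intros continuous_on_compose2[OF deriv_family_continuous_on[OF D]])
          (auto simp del: atLeastAtMost_iff)
    qed (use x in auto)
  qed
  show "D 0 x = D 0 t + (x - t) * E 0 x" if x: "x \<in> {a..b}" for x
  proof -
    have "((\<lambda>s. D (Suc 0) (t + s * (x - t)) * (x - t)) has_integral
        D 0 (t + 1 * (x - t)) - D 0 (t + 0 * (x - t))) {0..1}"
    proof (rule fundamental_theorem_of_calculus)
      fix s :: real assume "s \<in> {0..1}"
      then show "((\<lambda>s. D 0 (t + s * (x - t))) has_vector_derivative
          D (Suc 0) (t + s * (x - t)) * (x - t)) (at s within {0..1})"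
        unfolding has_real_derivative_iff_has_vector_derivative[symmetric]
        using x by (intro deriv seg) (auto intro!: derivative_eq_intros)
    qed simp
    from integral_unique[OF this]
    have "integral {0..1} (\<lambda>s. D (Suc 0) (t + s * (x - t)) * (x - t)) = D 0 x - D 0 t"
      by simp
    then show ?thesis by (simp add: E_def mult.commute)
  qed
  show "E k t = D (Suc k) t / real (Suc k)" for k
  proof -
    have "((\<lambda>s. s ^ k) has_integral 1 ^ Suc k / real (Suc k) - 0 ^ Suc k / real (Suc k)) {0..1::real}"
    proof (rule fundamental_theorem_of_calculus)
      fix s :: real
      show "((\<lambda>s. s ^ Suc k / real (Suc k)) has_vector_derivative s ^ k) (at s within {0..1})"
        unfolding has_real_derivative_iff_has_vector_derivative[symmetric]
        using DERIV_cdivide[OF DERIV_pow[of "Suc k" s "{0..1}"], of "real (Suc k)"]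
        by (simp del: of_nat_Suc power_Suc)
    qed simp
    then have "integral {0..1} (\<lambda>s::real. s ^ k) = 1 / real (Suc k)"
      by (simp add: integral_unique)
    then show ?thesis by (simp add: E_def)
  qed
qed

text \<open>Iterating Hadamard's lemma: \<open>E 0\<close> is the Taylor remainder of order \<open>m\<close> divided by
  \<open>(x - t) ^ m\<close>. The values of all its derivatives at \<open>t\<close> are carried along since the next
  division needs them.\<close>

lemma smooth_taylor_quotient:
  assumes t: "t \<in> {a..b}" and D: "deriv_family {a..b} D"
  shows "\<exists>E. deriv_family {a..b} E \<and>
    (\<forall>x\<in>{a..b}. D 0 x = (\<Sum>i<m. D i t / fact i * (x - t) ^ i) + (x - t) ^ m * E 0 x) \<and>
    (\<forall>k. E k t = D (k + m) t * fact k / fact (k + m))"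
proof (induction m)
  case 0
  show ?case using D by (intro exI[of _ D]) simp
next
  case (Suc m)
  then obtain E where E: "deriv_family {a..b} E"
    and eq: "\<And>x. x \<in> {a..b} \<Longrightarrow> D 0 x = (\<Sum>i<m. D i t / fact i * (x - t) ^ i) + (x - t) ^ m * E 0 x"
    and val: "\<And>k. E k t = D (k + m) t * fact k / fact (k + m)"
    by blast
  obtain F where F: "deriv_family {a..b} F"
    and eqF: "\<And>x. x \<in> {a..b} \<Longrightarrow> E 0 x = E 0 t + (x - t) * F 0 x"
    and valF: "\<And>k. F k t = E (Suc k) t / real (Suc k)"
    using hadamard_division[OF t E] by blast
  have "D 0 x = (\<Sum>i<Suc m. D i t / fact i * (x - t) ^ i) + (x - t) ^ Suc m * F 0 x"
    if "x \<in> {a..b}" for x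
    using eq[OF that] by (simp add: eqF[OF that] val algebra_simps)
  moreover have "F k t = D (k + Suc m) t * fact k / fact (k + Suc m)" for k
    unfolding valF val by (simp add: field_simps del: of_nat_Suc)
  ultimately show ?case using F by blast
qed

section \<open>The trapezoidal rule on a smooth periodic function\<close>

lemma deriv_family_periodic:
  assumes D: "deriv_family UNIV D" and per: "\<And>x. D 0 (x + T) = D 0 x"
  shows "D k (x + T) = D k x"
proof (induction k arbitrary: x)
  case (Suc k)
  have "((\<lambda>x. D k (x + T)) has_real_derivative D (Suc k) (x + T)) (at x)"
    using deriv_familyD[OF D, of "x + T" k] by (simp add: DERIV_shift)
  then have "(D k has_real_derivative D (Suc k) (x + T)) (at x)"
    by (simp add: Suc.IH)
  moreover have "(D k has_real_derivative D (Suc k) x) (at x)"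
    using deriv_familyD[OF D, of x k] by simp
  ultimately show ?case by (rule DERIV_unique)
qed (rule per)

text \<open>Expand the integral of \<open>D 0\<close> over each cell of length \<open>h\<close> in powers of \<open>h\<close> at its left end point and
  add up. The term of degree \<open>1\<close> is the trapezoidal sum of \<open>D 0\<close>; the term of degree \<open>i + 1\<close> is
  \<open>h ^ i / (i + 1)!\<close> times the trapezoidal sum of \<open>D i\<close>. By periodicity \<open>D i\<close> has integral \<open>0\<close> for
  \<open>i \<ge> 1\<close>, so its sum is itself a quadrature error, of size \<open>O(h ^ (N - i))\<close> by induction. This
  replaces the Bernoulli numbers of the Euler--Maclaurin formula.\<close>

lemma trapezoidal_deriv_family:
  assumes T: "T > 0" and N: "N \<ge> 1"
    and D: "deriv_family UNIV D" and per: "\<And>x. D 0 (x + T) = D 0 x"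
  shows "\<exists>C. \<forall>n\<ge>1. \<bar>T / real n * (\<Sum>j<n. D 0 (t + real j * (T / real n))) - integral {t..t+T} (D 0)\<bar>
           \<le> C * (T / real n) ^ N"
  using N D per
proof (induction N arbitrary: D rule: less_induct)
  case (less N)
  note D = \<open>deriv_family UNIV D\<close>
  define S where "S = (\<lambda>i n. T / real n * (\<Sum>j<n. D i (t + real j * (T / real n))))"
  have "\<exists>C. \<forall>n\<ge>1. \<bar>S i n\<bar> \<le> C * (T / real n) ^ (N - i)" if i: "i \<in> {1..<N}" for i
  proof -
    have fam: "deriv_family UNIV (\<lambda>k. D (k + i))"
      using D by (simp add: deriv_family_def)
    obtain i' where i': "i = Suc i'" using i by (cases i) auto
    have "(D i has_integral D i' (t + T) - D i' t) {t..t+T}"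
    proof (rule fundamental_theorem_of_calculus)
      fix x
      have "(D i' has_real_derivative D i x) (at x within {t..t+T})"
        using deriv_familyD[OF D, of x i']
        by (simp add: i' has_field_derivative_at_within)
      then show "(D i' has_vector_derivative D i x) (at x within {t..t+T})"
        by (simp add: has_real_derivative_iff_has_vector_derivative)
    qed (use T in simp)
    then have "integral {t..t+T} (D i) = 0"
      using deriv_family_periodic[OF D less.prems(3)] by (simp add: integral_unique)
    then show ?thesis
      using less.IH[of "N - i" "\<lambda>k. D (k + i)"] i fam deriv_family_periodic[OF D less.prems(3)]
      by (auto simp: S_def)
  qed
  then obtain C where C: "\<And>i n. i \<in> {1..<N} \<Longrightarrow> n \<ge> 1 \<Longrightarrow> \<bar>S i n\<bar> \<le> C i * (T / real n) ^ (N - i)"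
    by metis
  have cont: "continuous_on A (D i)" for i A
    by (rule continuous_on_subset[OF deriv_family_continuous_on[OF D]]) auto
  have "compact (D N ` {t..t+T})"
    by (intro compact_continuous_image cont) auto
  then obtain B where B: "\<And>x. x \<in> {t..t+T} \<Longrightarrow> \<bar>D N x\<bar> \<le> B"
    by (fastforce dest!: compact_imp_bounded simp: bounded_real)
  define F where "F = (\<lambda>x. integral {t..x} (D 0))"
  \<comment> \<open>the antiderivative \<open>F\<close> followed by \<open>D 0, D 1, \<dots>\<close>: the derivative family of \<open>F\<close>\<close>
  define G where "G = (\<lambda>i. case i of 0 \<Rightarrow> F | Suc i \<Rightarrow> D i)"
  have G: "(G i has_real_derivative G (Suc i) x) (at x within {t..t+T})" if "x \<in> {t..t+T}" for x i
  proof (cases i)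
    case 0
    then show ?thesis
      unfolding G_def F_def using integral_has_real_derivative[OF cont that] by simp
  next
    case (Suc i')
    then show ?thesis
      using deriv_familyD[OF D, of x i'] by (simp add: G_def has_field_derivative_at_within)
  qed
  have "\<bar>S 0 n - integral {t..t+T} (D 0)\<bar> \<le> (T * B / fact N + (\<Sum>i\<in>{1..<N}. C i)) * (T / real n) ^ N"
    if n: "n \<ge> 1" for n
  proof -
    define h where "h = T / real n"
    define x where "x = (\<lambda>j. t + real j * h)"
    have h: "h > 0" "real n * h = T" using T n by (simp_all add: h_def)
    have x: "x j \<in> {t..t+T}" if "j \<le> n" for j
    proof -
      have "real j * h \<le> real n * h" using that h by (intro mult_right_mono) auto
      then show ?thesis using h by (simp add: x_def)
    qed
    have xSuc: "x (Suc j) - x j = h" for j by (simp add: x_def algebra_simps)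
    have xn: "x n = t + T" using h by (simp add: x_def)
    have step: "\<bar>F (x (Suc j)) - F (x j) - (\<Sum>i<N. D i (x j) * h ^ Suc i / fact (Suc i))\<bar> \<le> B * h ^ Suc N / fact N"
      if "j < n" for j
    proof -
      have "norm (G 0 (x (Suc j)) - (\<Sum>i\<le>N. G i (x j) * (x (Suc j) - x j) ^ i / fact i))
          \<le> B * norm (x (Suc j) - x j) ^ Suc N / fact N"
        by (rule field_Taylor[of "{t..t+T}"]) (use G B x that in \<open>auto simp: G_def\<close>)
      moreover have "(\<Sum>i\<le>N. G i (x j) * h ^ i / fact i) = F (x j) + (\<Sum>i<N. D i (x j) * h ^ Suc i / fact (Suc i))"
        unfolding sum.atMost_shift by (simp add: G_def)
      ultimately show ?thesis unfolding xSuc using h by (simp add: G_def algebra_simps)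
    qed
    have "\<bar>\<Sum>j<n. F (x (Suc j)) - F (x j) - (\<Sum>i<N. D i (x j) * h ^ Suc i / fact (Suc i))\<bar>
        \<le> (\<Sum>j<n. B * h ^ Suc N / fact N)"
      by (rule order.trans[OF sum_abs sum_mono]) (use step in auto)
    also have "\<dots> = (real n * h) * B / fact N * h ^ N" by simp
    also have "(\<Sum>j<n. F (x (Suc j)) - F (x j) - (\<Sum>i<N. D i (x j) * h ^ Suc i / fact (Suc i)))
        = integral {t..t+T} (D 0) - (\<Sum>i<N. h ^ i / fact (Suc i) * S i n)"
    proof -
      have "(\<Sum>j<n. F (x (Suc j)) - F (x j)) = integral {t..t+T} (D 0)"
        using sum_lessThan_telescope[of "\<lambda>j. F (x j)" n] by (simp add: xn) (simp add: F_def x_def)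
      moreover have "(\<Sum>j<n. \<Sum>i<N. D i (x j) * h ^ Suc i / fact (Suc i)) = (\<Sum>i<N. h ^ i / fact (Suc i) * S i n)"
        unfolding S_def x_def h_def
        by (subst sum.swap) (simp add: sum_distrib_left sum_divide_distrib mult_ac)
      ultimately show ?thesis by (simp add: sum_subtractf)
    qed
    also have "(\<Sum>i<N. h ^ i / fact (Suc i) * S i n) = S 0 n + (\<Sum>i\<in>{1..<N}. h ^ i / fact (Suc i) * S i n)"
    proof -
      have "{..<N} = insert 0 {1..<N}" using less.prems(1) by auto
      then show ?thesis by simp
    qed
    finally have 1: "\<bar>integral {t..t+T} (D 0) - (S 0 n + (\<Sum>i\<in>{1..<N}. h ^ i / fact (Suc i) * S i n))\<bar>
        \<le> T * B / fact N * h ^ N"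
      using h by simp
    have "\<bar>\<Sum>i\<in>{1..<N}. h ^ i / fact (Suc i) * S i n\<bar> \<le> (\<Sum>i\<in>{1..<N}. C i * h ^ N)"
    proof (rule order.trans[OF sum_abs sum_mono])
      fix i assume i: "i \<in> {1..<N}"
      have "h ^ i / fact (Suc i) \<le> h ^ i / 1"
        using h by (intro divide_left_mono fact_ge_1) auto
      then have "\<bar>h ^ i / fact (Suc i) * S i n\<bar> \<le> h ^ i * (C i * h ^ (N - i))"
        unfolding abs_mult using C[OF i n] h by (intro mult_mono) (auto simp: h_def)
      also have "\<dots> = C i * h ^ N"
        using i by (simp add: power_add[symmetric])
      finally show "\<bar>h ^ i / fact (Suc i) * S i n\<bar> \<le> C i * h ^ N" .
    qed
    with 1 show ?thesis
      unfolding h_def[symmetric] distrib_right sum_distrib_right by linarith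
  qed
  then show ?case unfolding S_def by blast
qed

lemma trapezoidal_periodic:
  assumes "T > 0" and "smooth_on UNIV u" and per: "\<And>x. u (x + T) = u x" and "N \<ge> 1"
  shows "\<exists>C. \<forall>n\<ge>1. \<bar>T / real n * (\<Sum>j<n. u (t + real j * (T / real n))) - integral {t..t+T} u\<bar>
           \<le> C * (T / real n) ^ N"
proof -
  obtain D where D: "\<And>x. D 0 x = u x" "deriv_family UNIV D"
    using assms(2) by (auto simp: smooth_on_altdef)
  then have "D 0 = u" by auto
  then show ?thesis
    using trapezoidal_deriv_family[OF assms(1,4) D(2)] per by auto
qed

section \<open>Periodic functions with a single pole\<close>

text \<open>For \<open>k \<ge> 2\<close> this is \<open>\<Sum>p\<ge>0. (y + p) ^ (-k)\<close>, see \<open>half_lattice_sum_sums\<close>. The polygamma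
  functions provide the regularised value for \<open>k = 1\<close>, where the series diverges, and obey
  the same functional equation and the same rule of differentiation for all \<open>k \<ge> 1\<close>.\<close>

definition half_lattice_sum :: "nat \<Rightarrow> real \<Rightarrow> real" where
  "half_lattice_sum k y = (- 1) ^ k / fact (k - 1) * Polygamma (k - 1) y"

text \<open>The series of \<open>(y + p) ^ (-k)\<close> over all integers \<open>p\<close>, folded into one term for \<open>p \<ge> 0\<close> and one for
  \<open>p < 0\<close>. For \<open>k = 1\<close> the two regularisations combine to \<open>\<pi> cot (\<pi> y)\<close>.\<close>

definition lattice_sum :: "nat \<Rightarrow> real \<Rightarrow> real" where
  "lattice_sum k y = half_lattice_sum k y + (- 1) ^ k * half_lattice_sum k (1 - y)"

text \<open>The series of \<open>(y + p) ^ (-k)\<close> over all integers \<open>p \<noteq> 0\<close>: the part of \<open>lattice_sum k\<close> that stays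
  smooth at \<open>y = 0\<close>. For \<open>k = 1\<close> it is the limit of the sums over \<open>0 < \<bar>p\<bar> \<le> P\<close>.\<close>

definition lattice_sum_reg :: "nat \<Rightarrow> real \<Rightarrow> real" where
  "lattice_sum_reg k y = half_lattice_sum k (y + 1) + (- 1) ^ k * half_lattice_sum k (1 - y)"

lemma half_lattice_sum_shift:
  assumes "y \<noteq> 0" "k \<ge> 1"
  shows "half_lattice_sum k y = 1 / y ^ k + half_lattice_sum k (y + 1)"
proof -
  obtain j where k: "k = Suc j" using assms(2) by (cases k) auto
  show ?thesis
    unfolding half_lattice_sum_def k Polygamma_plus1[OF assms(1)] by (simp add: field_simps power_mult_distrib[symmetric])
qed

lemma lattice_sum_split: "y \<noteq> 0 \<Longrightarrow> k \<ge> 1 \<Longrightarrow> lattice_sum k y = 1 / y ^ k + lattice_sum_reg k y"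
  by (simp add: lattice_sum_def lattice_sum_reg_def half_lattice_sum_shift[of y k])

lemma lattice_sum_periodic:
  assumes "y \<noteq> 0" "k \<ge> 1"
  shows "lattice_sum k (y + 1) = lattice_sum k y"
proof -
  have "(- 1) ^ k * (1 / (- y) ^ k) = 1 / y ^ k"
    by (simp add: power_minus[of y])
  then show ?thesis
    using half_lattice_sum_shift[of y k] half_lattice_sum_shift[of "- y" k] assms by (simp add: lattice_sum_def algebra_simps)
qed

lemma lattice_sum_reflect: "lattice_sum k (1 - y) = (- 1) ^ k * lattice_sum k y"
  by (simp add: lattice_sum_def algebra_simps power_mult_distrib[symmetric] mult.assoc[symmetric])

lemma half_lattice_sum_derivative:
  assumes "y \<notin> \<int>\<^sub>\<le>\<^sub>0" "k \<ge> 1"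
  shows "(half_lattice_sum k has_real_derivative - real k * half_lattice_sum (Suc k) y) (at y within A)"
proof -
  obtain j where k: "k = Suc j" using assms(2) by (cases k) auto
  have "((\<lambda>y. (- 1) ^ k / fact j * Polygamma j y) has_real_derivative
      (- 1) ^ k / fact j * Polygamma (Suc j) y) (at y within A)"
    by (intro DERIV_cmult has_field_derivative_Polygamma assms)
  moreover have "(- 1) ^ k / fact j * Polygamma (Suc j) y = - real k * half_lattice_sum (Suc k) y"
    by (simp add: half_lattice_sum_def k field_simps del: of_nat_Suc)
  ultimately show ?thesis by (simp add: half_lattice_sum_def[abs_def] k)
qed

lemma smooth_on_half_lattice_sum: "smooth_on (- \<int>\<^sub>\<le>\<^sub>0) (half_lattice_sum k)"
  unfolding smooth_on_altdef deriv_family_def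
proof (intro exI[of _ "\<lambda>j y. (- 1) ^ k / fact (k - 1) * Polygamma (k - 1 + j) y"] conjI allI ballI)
  fix j :: nat and y :: real
  assume "y \<in> - \<int>\<^sub>\<le>\<^sub>0"
  then have "((\<lambda>y. (- 1) ^ k / fact (k - 1) * Polygamma (k - 1 + j) y) has_real_derivative
      (- 1) ^ k / fact (k - 1) * Polygamma (Suc (k - 1 + j)) y) (at y within - \<int>\<^sub>\<le>\<^sub>0)"
    by (intro DERIV_cmult has_field_derivative_Polygamma) auto
  then show "((\<lambda>y. (- 1) ^ k / fact (k - 1) * Polygamma (k - 1 + j) y) has_real_derivative
      (- 1) ^ k / fact (k - 1) * Polygamma (k - 1 + Suc j) y) (at y within - \<int>\<^sub>\<le>\<^sub>0)"
    by simp
qed (simp add: half_lattice_sum_def)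

lemma pos_not_nonpos_Ints: "y > 0 \<Longrightarrow> (y::real) \<notin> \<int>\<^sub>\<le>\<^sub>0"
  by (auto elim!: nonpos_Ints_cases)

lemma smooth_on_lattice_sum_reg: "smooth_on {- 1<..<1} (lattice_sum_reg k)"
proof -
  have "smooth_on {- 1<..<1} (\<lambda>y. half_lattice_sum k (1 * y + 1) + (- 1) ^ k * half_lattice_sum k (- 1 * y + 1))"
    by (intro smooth_on_add smooth_on_cmult smooth_on_affine[OF smooth_on_half_lattice_sum])
      (auto intro!: pos_not_nonpos_Ints)
  then show ?thesis by (simp add: lattice_sum_reg_def[abs_def])
qed

lemma smooth_on_lattice_sum: "smooth_on (- \<int>) (lattice_sum k)"
proof -
  have sub: "- \<int> \<subseteq> - (\<int>\<^sub>\<le>\<^sub>0 :: real set)"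
    by (auto elim!: nonpos_Ints_cases)
  have "smooth_on (- \<int>) (\<lambda>y. half_lattice_sum k y + (- 1) ^ k * half_lattice_sum k (- 1 * y + 1))"
  proof (rule smooth_on_add[OF smooth_on_subset[OF smooth_on_half_lattice_sum sub]
        smooth_on_cmult[OF smooth_on_affine[OF smooth_on_half_lattice_sum]]])
    fix y :: real assume y: "y \<in> - \<int>"
    have "y = 1 - (- 1 * y + 1)" by simp
    then have "- 1 * y + 1 \<notin> \<int>" using y by (metis ComplD Ints_1 Ints_diff)
    then show "- 1 * y + 1 \<in> - \<int>\<^sub>\<le>\<^sub>0" using sub by blast
  qed
  then show ?thesis by (simp add: lattice_sum_def[abs_def])
qed

lemma half_lattice_sum_sums:
  assumes "k \<ge> 2" "y > 0"
  shows "(\<lambda>p. 1 / (y + real p) ^ k) sums half_lattice_sum k y"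
proof -
  obtain j where k: "k = Suc j" "j > 0" using assms(1) by (cases k) auto
  show ?thesis
    using Polygamma_LIMSEQ[of y j] assms(2) k(2)
    by (simp add: k(1) half_lattice_sum_def inverse_eq_divide)
qed

lemma half_lattice_sum_1: "k \<ge> 2 \<Longrightarrow> half_lattice_sum k 1 = Re (zeta (of_nat k))"
  using half_lattice_sum_sums[of k 1] zeta_nat_sums[of k] by (auto dest: sums_unique2 simp: add.commute)

lemma lattice_sum_reg_0: "lattice_sum_reg k 0 = (if even k then 2 * half_lattice_sum k 1 else 0)"
  by (simp add: lattice_sum_reg_def)

text \<open>Every positive integer has a unique form \<open>j + p n\<close> with \<open>1 \<le> j \<le> n\<close> and \<open>p \<ge> 0\<close>, so the \<open>n\<close> series
  on the left together are the series at \<open>1\<close>, scaled by \<open>n ^ k\<close>.\<close>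

lemma sum_half_lattice_sum:
  assumes k: "k \<ge> 2" and n: "n \<ge> 1"
  shows "(\<Sum>j=1..n. half_lattice_sum k (real j / real n)) = real n ^ k * half_lattice_sum k 1"
proof -
  have "(\<lambda>p. \<Sum>j\<in>{1..n}. 1 / (real j / real n + real p) ^ k) sums (\<Sum>j=1..n. half_lattice_sum k (real j / real n))"
    using n by (intro sums_sum half_lattice_sum_sums k) auto
  moreover have "(\<lambda>p. \<Sum>q\<in>{p*n..<p*n+n}. 1 / (1 + real q) ^ k) sums half_lattice_sum k 1"
    using n by (intro sums_group half_lattice_sum_sums k) auto
  then have "(\<lambda>p. real n ^ k * (\<Sum>q\<in>{p*n..<p*n+n}. 1 / (1 + real q) ^ k)) sums (real n ^ k * half_lattice_sum k 1)"
    by (rule sums_mult)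
  moreover have "real n ^ k * (\<Sum>q\<in>{p*n..<p*n+n}. 1 / (1 + real q) ^ k)
      = (\<Sum>j\<in>{1..n}. 1 / (real j / real n + real p) ^ k)" for p
    unfolding sum_distrib_left
  \<comment> \<open>the summation index \<open>q\<close> starts at \<open>0\<close>, the residue \<open>j\<close> at \<open>1\<close>\<close>
  proof (rule sum.reindex_bij_witness[of _ "\<lambda>j. j - 1 + p * n" "\<lambda>q. q + 1 - p * n"])
    fix q assume q: "q \<in> {p*n..<p*n+n}"
    have "real (q + 1 - p * n) / real n + real p = (1 + real q) / real n"
      using q n by (simp add: of_nat_diff field_simps)
    then show "1 / (real (q + 1 - p * n) / real n + real p) ^ k = real n ^ k * (1 / (1 + real q) ^ k)"
      by (simp add: power_divide)
  qed auto
  ultimately show ?thesis by (simp add: sums_unique2)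
qed

text \<open>The reflection \<open>j \<mapsto> n - j\<close> exchanges the two halves of \<open>lattice_sum\<close>. For odd \<open>k\<close> they cancel, also
  when \<open>k = 1\<close>; for even \<open>k\<close> they agree, and the missing term \<open>j = n\<close> accounts for the \<open>- 1\<close>.\<close>

lemma sum_lattice_sum:
  assumes k: "k \<ge> 1" and n: "n \<ge> 1"
  shows "(\<Sum>j=1..<n. lattice_sum k (real j / real n))
           = (if even k then 2 * (real n ^ k - 1) * Re (zeta (of_nat k)) else 0)"
proof -
  have refl: "(\<Sum>j=1..<n. F (1 - real j / real n)) = (\<Sum>j=1..<n. F (real j / real n))" for F :: "real \<Rightarrow> real"
    by (rule sum.reindex_bij_witness[of _ "\<lambda>j. n - j" "\<lambda>j. n - j"])
      (auto simp: of_nat_diff diff_divide_distrib)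
  show ?thesis
  proof (cases "even k")
    case True
    then have k2: "k \<ge> 2" using k by (cases "k = 1") auto
    have "(\<Sum>j=1..<n. lattice_sum k (real j / real n)) = 2 * (\<Sum>j=1..<n. half_lattice_sum k (real j / real n))"
      using True refl[of "half_lattice_sum k"] by (simp add: lattice_sum_def sum.distrib)
    also have "{1..n} = insert n {1..<n}" using n by auto
    then have "(\<Sum>j=1..<n. half_lattice_sum k (real j / real n)) = real n ^ k * half_lattice_sum k 1 - half_lattice_sum k 1"
      using sum_half_lattice_sum[OF k2 n] n by simp
    finally show ?thesis using True by (simp add: half_lattice_sum_1[OF k2] algebra_simps)
  next
    case False
    then have "(\<Sum>j=1..<n. lattice_sum k (real j / real n)) = - (\<Sum>j=1..<n. lattice_sum k (1 - real j / real n))"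
      by (simp add: lattice_sum_reflect sum_negf)
    then show ?thesis using False refl[of "lattice_sum k"] by simp
  qed
qed

text \<open>For \<open>k \<ge> 2\<close> the antiderivative is \<open>- lattice_sum (k - 1) / (k - 1)\<close>, for \<open>k = 1\<close> it is built from
  \<open>ln_Gamma\<close>. The latter is symmetric about \<open>1 / 2\<close>, in agreement with the factor
  \<open>1 + (- 1) ^ k = 0\<close>.\<close>

lemma lattice_sum_antiderivative:
  assumes k: "k \<ge> 1"
  obtains W where "\<And>y. y \<in> {0<..<1} \<Longrightarrow> (W has_real_derivative lattice_sum k y) (at y)"
    "\<And>y. y \<in> {0<..<1} \<Longrightarrow> W (1 - y) - W y = (1 + (- 1) ^ k) / (real k - 1) * lattice_sum (k - 1) y"
proof (cases "k = 1")
  case True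
  define W where "W = (\<lambda>y. - ln_Gamma y - ln_Gamma (1 - y :: real))"
  have "(W has_real_derivative lattice_sum k y) (at y)" if "y \<in> {0<..<1}" for y
    unfolding W_def True lattice_sum_def half_lattice_sum_def using that
    by (auto intro!: derivative_eq_intros)
  then show ?thesis using True by (intro that[of W]) (auto simp: W_def)
next
  case False
  with k obtain j where j: "k = Suc j" "j \<ge> 1" by (cases k) auto
  define W where "W = (\<lambda>y. - lattice_sum j y / real j)"
  have "(W has_real_derivative lattice_sum k y) (at y)" if y: "y \<in> {0<..<1}" for y
  proof -
    have "((\<lambda>y. half_lattice_sum j (1 - y)) has_real_derivative - real j * half_lattice_sum k (1 - y) * (- 1)) (at y)"
      unfolding j(1)
      by (rule DERIV_chain2[of "half_lattice_sum j"])
        (use y j half_lattice_sum_derivative[OF pos_not_nonpos_Ints, of "1 - y" j] in \<open>auto intro!: derivative_eq_intros\<close>)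
    moreover have "(half_lattice_sum j has_real_derivative - real j * half_lattice_sum k y) (at y)"
      unfolding j(1) using y j by (intro half_lattice_sum_derivative pos_not_nonpos_Ints) auto
    ultimately have "((\<lambda>y. - (half_lattice_sum j y + (- 1) ^ j * half_lattice_sum j (1 - y)) / real j) has_real_derivative
        - (- real j * half_lattice_sum k y + (- 1) ^ j * (- real j * half_lattice_sum k (1 - y) * (- 1))) / real j) (at y)"
      by (intro DERIV_cdivide DERIV_minus DERIV_add DERIV_cmult)
    moreover have "- (- real j * half_lattice_sum k y + (- 1) ^ j * (- real j * half_lattice_sum k (1 - y) * (- 1))) / real j = lattice_sum k y"
      using j by (simp add: lattice_sum_def field_simps)
    ultimately show ?thesis by (simp add: W_def lattice_sum_def)
  qed
  moreover have "W (1 - y) - W y = (1 + (- 1) ^ k) / (real k - 1) * lattice_sum (k - 1) y" for y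
    using j by (simp add: W_def lattice_sum_reflect field_simps)
  ultimately show ?thesis by (rule that)
qed

text \<open>The factor \<open>T ^ k\<close> makes the leading term at \<open>t\<close> exactly \<open>1 / (x - t) ^ k\<close>.\<close>

definition scaled_pole :: "real \<Rightarrow> real \<Rightarrow> nat \<Rightarrow> real \<Rightarrow> real" where
  "scaled_pole T t k x = lattice_sum k ((x - t) / T) / T ^ k"

lemma mem_punctured_line:
  assumes "T > 0"
  shows "x \<in> punctured_line t T \<longleftrightarrow> (x - t) / T \<notin> \<int>"
proof -
  have "(\<exists>k::int. x = t + of_int k * T) \<longleftrightarrow> (\<exists>k::int. (x - t) / T = of_int k)"
    using assms by (simp add: field_simps)
  then show ?thesis
    by (auto simp: punctured_line_def elim!: Ints_cases)
qed

lemma open_punctured_line: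
  assumes "T > 0"
  shows "open (punctured_line t T)"
proof -
  have "punctured_line t T = (\<lambda>x. (x - t) / T) -` (- \<int>)"
    using mem_punctured_line[OF assms] by auto
  moreover have "open ((\<lambda>x. (x - t) / T) -` (- \<int>))"
    using assms by (intro open_vimage open_Compl closed_Ints continuous_intros) auto
  ultimately show ?thesis by simp
qed

lemma punctured_line_shift:
  assumes "T > 0"
  shows "x + of_int j * T \<in> punctured_line t T \<longleftrightarrow> x \<in> punctured_line t T"
proof -
  have "(x + of_int j * T - t) / T = (x - t) / T + of_int j"
    using assms by (simp add: field_simps)
  then show ?thesis by (simp add: mem_punctured_line[OF assms])
qed

lemma near_puncture:
  assumes "T > 0" "x \<noteq> t" "\<bar>x - t\<bar> < T"
  shows "x \<in> punctured_line t T"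
proof -
  have "\<bar>(x - t) / T\<bar> < 1" using assms by (simp add: abs_divide)
  moreover have "(x - t) / T \<noteq> 0" using assms by simp
  ultimately show ?thesis
    unfolding mem_punctured_line[OF assms(1)] by (metis Ints_nonzero_abs_less1)
qed

lemma periodic_int_multiple:
  fixes u :: "real \<Rightarrow> 'a"
  assumes per: "\<And>x. u (x + T) = u x"
  shows "u (x + of_int j * T) = u x"
proof (induction j rule: int_induct[of _ 0])
  case (step1 i)
  then show ?case using per[of "x + of_int i * T"] by (simp add: algebra_simps)
next
  case (step2 i)
  then show ?case using per[of "x + of_int (i - 1) * T"] by (simp add: algebra_simps)
qed simp

lemma smooth_on_scaled_pole:
  assumes "T > 0"
  shows "smooth_on (punctured_line t T) (scaled_pole T t k)"
proof -
  have eq: "(x - t) / T = 1 / T * x + (- t / T)" for x by (simp add: diff_divide_distrib)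
  have "smooth_on (punctured_line t T) (\<lambda>x. 1 / T ^ k * lattice_sum k (1 / T * x + (- t / T)))"
    by (intro smooth_on_cmult smooth_on_affine[OF smooth_on_lattice_sum])
      (simp add: mem_punctured_line[OF assms] eq)
  then show ?thesis by (simp add: scaled_pole_def[abs_def] eq)
qed

lemma scaled_pole_periodic:
  assumes "T > 0" "k \<ge> 1" "x \<in> punctured_line t T"
  shows "scaled_pole T t k (x + T) = scaled_pole T t k x"
proof -
  have "(x + T - t) / T = (x - t) / T + 1" using assms by (simp add: field_simps)
  moreover have "(x - t) / T \<noteq> 0"
    using assms(3) unfolding mem_punctured_line[OF assms(1)] by (metis Ints_0)
  ultimately show ?thesis unfolding scaled_pole_def using lattice_sum_periodic[OF _ assms(2)] by metis
qed

lemma scaled_pole_split: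
  assumes "T > 0" "k \<ge> 1" "x \<noteq> t"
  shows "scaled_pole T t k x = 1 / (x - t) ^ k + lattice_sum_reg k ((x - t) / T) / T ^ k"
  using assms by (simp add: scaled_pole_def lattice_sum_split power_divide add_divide_distrib)

section \<open>Splitting off the singular part\<close>

text \<open>Near \<open>t\<close> the sum of the scaled poles removes the first \<open>m\<close> terms of the Taylor expansion of \<open>g\<close> divided
  by \<open>(x - t) ^ m\<close>; the rest is the smooth Taylor quotient minus the regular parts of the poles.
  The value of \<open>u\<close> at \<open>t\<close> is the value of this rest. As \<open>f\<close> and the poles are periodic and smooth
  on the punctured line, no singularity arises at the seam \<open>a + T = b\<close>.\<close>

lemma subtract_singular_part:
  fixes a b t T :: real and m :: nat and f g :: "real \<Rightarrow> real"
  assumes ab: "a < t" "t < b" and T: "T = b - a"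
    and g: "smooth_on {a..b} g"
    and f: "smooth_on (punctured_line t T) f"
    and per: "\<And>x. x \<in> punctured_line t T \<Longrightarrow> f (x + T) = f x"
    and fg: "\<And>x. x \<in> {a..b} - {t} \<Longrightarrow> f x = g x / (x - t) ^ m"
  defines "c \<equiv> \<lambda>k. (deriv ^^ (m - k)) g t / fact (m - k)"
  obtains u where "smooth_on UNIV u" "\<And>x. u (x + T) = u x"
    "\<And>x. x \<in> punctured_line t T \<Longrightarrow> f x = (\<Sum>k=1..m. c k * scaled_pole T t k x) + u x"
    "u t = c 0 - (\<Sum>k=1..m. c k * (lattice_sum_reg k 0 / T ^ k))"
proof -
  have T0: "T > 0" using ab T by simp
  have tab: "t \<in> {a..b}" using ab by simp
  obtain D where D: "\<And>x. x \<in> {a..b} \<Longrightarrow> D 0 x = g x" "deriv_family {a..b} D"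
    using g unfolding smooth_on_altdef by blast
  have Dt: "D i t = (deriv ^^ i) g t" for i
    by (rule deriv_family_eq_higher_deriv[of "{a<..<b}"])
      (use D ab in \<open>auto intro: deriv_family_subset[OF D(2)]\<close>)
  obtain E where E: "deriv_family {a..b} E"
    and gE: "\<And>x. x \<in> {a..b} \<Longrightarrow> D 0 x = (\<Sum>i<m. D i t / fact i * (x - t) ^ i) + (x - t) ^ m * E 0 x"
    and Et: "\<And>k. E k t = D (k + m) t * fact k / fact (k + m)"
    using smooth_taylor_quotient[OF tab D(2), of m] by blast
  \<comment> \<open>the smooth function which \<open>u\<close> has to equal near \<open>t\<close>\<close>
  define w where "w = (\<lambda>x. E 0 x - (\<Sum>k=1..m. c k * (1 / T ^ k * lattice_sum_reg k (1 / T * x + (- t / T)))))"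
  have aff: "1 / T * x + (- t / T) = (x - t) / T" for x by (simp add: diff_divide_distrib)
  have w_smooth: "smooth_on {a<..<b} w"
    unfolding w_def
  proof (intro smooth_on_diff smooth_on_sum smooth_on_cmult smooth_on_affine[OF smooth_on_lattice_sum_reg])
    show "smooth_on {a<..<b} (E 0)"
      by (rule smooth_on_subset[of "{a..b}"]) (use E in \<open>auto simp: smooth_on_altdef\<close>)
    show "1 / T * x + (- t / T) \<in> {- 1<..<1}" if "x \<in> {a<..<b}" for x
      unfolding aff using that T T0 ab by (simp add: field_simps)
  qed
  have w: "f x - (\<Sum>k=1..m. c k * scaled_pole T t k x) = w x" if x: "x \<in> {a..b} - {t}" for x
  proof -
    have "f x = (\<Sum>i<m. D i t / fact i * (x - t) ^ i) / (x - t) ^ m + E 0 x"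
      using fg[OF x] gE[of x] D(1)[of x] x by (simp add: add_divide_distrib)
    also have "(\<Sum>i<m. D i t / fact i * (x - t) ^ i) / (x - t) ^ m = (\<Sum>k=1..m. c k * (1 / (x - t) ^ k))"
      unfolding sum_divide_distrib
    proof (rule sum.reindex_bij_witness[of _ "\<lambda>k. m - k" "\<lambda>i. m - i"])
      fix i assume i: "i \<in> {..<m}"
      have "(x - t) ^ m = (x - t) ^ i * (x - t) ^ (m - i)"
        using i by (simp add: power_add[symmetric])
      then show "c (m - i) * (1 / (x - t) ^ (m - i)) = D i t / fact i * (x - t) ^ i / (x - t) ^ m"
        using i x by (simp add: c_def Dt)
    qed auto
    finally have "f x = (\<Sum>k=1..m. c k * (1 / (x - t) ^ k)) + E 0 x" .
    moreover have "(\<Sum>k=1..m. c k * scaled_pole T t k x)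
        = (\<Sum>k=1..m. c k * (1 / (x - t) ^ k)) + (\<Sum>k=1..m. c k * (1 / T ^ k * lattice_sum_reg k ((x - t) / T)))"
      unfolding sum.distrib[symmetric]
      using x by (intro sum.cong) (auto simp: scaled_pole_split[OF T0] algebra_simps)
    ultimately show ?thesis unfolding w_def aff by linarith
  qed
  define u where "u = (\<lambda>x. if x \<in> punctured_line t T then f x - (\<Sum>k=1..m. c k * scaled_pole T t k x) else w t)"
  have u_per: "u (x + T) = u x" for x
    using punctured_line_shift[OF T0, of x 1 t]
    by (auto simp: u_def per scaled_pole_periodic[OF T0] intro!: sum.cong)
  have uw: "u x = w x" if "x \<in> {a<..<b}" for x
  proof (cases "x = t")
    case True
    have "t \<notin> punctured_line t T" by (simp add: mem_punctured_line[OF T0])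
    then show ?thesis using True by (simp add: u_def)
  next
    case False
    then have "x \<in> punctured_line t T"
      using that T ab by (intro near_puncture[OF T0]) auto
    then show ?thesis using w[of x] that False by (simp add: u_def)
  qed
  show ?thesis
  proof (rule that)
    show "smooth_on UNIV u"
    proof (rule smooth_on_local)
      fix x :: real
      show "\<exists>U. open U \<and> x \<in> U \<and> smooth_on U u"
      proof (cases "x \<in> punctured_line t T")
        case True
        have "smooth_on (punctured_line t T) (\<lambda>x. f x - (\<Sum>k=1..m. c k * scaled_pole T t k x))"
          by (intro smooth_on_diff smooth_on_sum smooth_on_cmult smooth_on_scaled_pole[OF T0] f)
        then have "smooth_on (punctured_line t T) u"
          by (rule smooth_on_cong) (simp add: u_def)
        then show ?thesis using True open_punctured_line[OF T0] by blast
      next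
        case False
        then obtain j where "(x - t) / T = of_int j"
          unfolding mem_punctured_line[OF T0] by (auto elim: Ints_cases)
        then have x: "x = t + of_int j * T" using T0 by (simp add: field_simps)
        let ?U = "{a + of_int j * T<..<b + of_int j * T}"
        have "smooth_on ?U (\<lambda>y. w (1 * y + - (of_int j * T)))"
          by (rule smooth_on_affine[OF w_smooth]) auto
        then have "smooth_on ?U u"
        proof (rule smooth_on_cong)
          fix y assume "y \<in> ?U"
          then have "w (y - of_int j * T) = u (y - of_int j * T)" by (intro uw[symmetric]) auto
          also have "\<dots> = u y"
            using periodic_int_multiple[of u T "y - of_int j * T" j, OF u_per] by simp
          finally show "w (1 * y + - (of_int j * T)) = u y" by simp
        qed
        then show ?thesis using ab x by (intro exI[of _ ?U]) auto
      qed
    qed simp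
    show "u t = c 0 - (\<Sum>k=1..m. c k * (lattice_sum_reg k 0 / T ^ k))"
      using uw[of t] ab by (simp add: w_def aff Et Dt c_def)
  qed (use u_per in \<open>auto simp: u_def\<close>)
qed

section \<open>The finite part integral\<close>

lemma scaled_pole_has_integral:
  assumes T: "T > 0" and k: "k \<ge> 1" and e: "0 < e" "2 * e \<le> T"
  shows "(scaled_pole T t k has_integral (1 + (- 1) ^ k) / (real k - 1) * (T / T ^ k * lattice_sum (k - 1) (e / T)))
           {t + e..t + T - e}"
proof -
  obtain W where W: "\<And>y. y \<in> {0<..<1} \<Longrightarrow> (W has_real_derivative lattice_sum k y) (at y)"
    and W1: "\<And>y. y \<in> {0<..<1} \<Longrightarrow> W (1 - y) - W y = (1 + (- 1) ^ k) / (real k - 1) * lattice_sum (k - 1) y"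
    using lattice_sum_antiderivative[OF k] by blast
  define F where "F = (\<lambda>x. T / T ^ k * W ((x - t) / T))"
  have "(scaled_pole T t k has_integral F (t + T - e) - F (t + e)) {t + e..t + T - e}"
  proof (rule fundamental_theorem_of_calculus)
    fix x assume x: "x \<in> {t + e..t + T - e}"
    have "((\<lambda>x. (x - t) / T) has_real_derivative 1 / T) (at x within {t + e..t + T - e})"
      using T by (auto intro!: derivative_eq_intros)
    moreover have "(W has_real_derivative lattice_sum k ((x - t) / T)) (at ((x - t) / T))"
      using x T e by (intro W) (auto simp: field_simps)
    ultimately have "((\<lambda>x. W ((x - t) / T)) has_real_derivative lattice_sum k ((x - t) / T) * (1 / T))
        (at x within {t + e..t + T - e})"
      by (rule DERIV_chain2[rotated])
    from DERIV_cmult[OF this, of "T / T ^ k"]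
    show "(F has_vector_derivative scaled_pole T t k x) (at x within {t + e..t + T - e})"
      unfolding F_def scaled_pole_def has_real_derivative_iff_has_vector_derivative[symmetric]
      using T by simp
  qed (use e in simp)
  moreover have "(t + T - e - t) / T = 1 - e / T" using T by (simp add: field_simps)
  then have "F (t + T - e) - F (t + e) = T / T ^ k * (W (1 - e / T) - W (e / T))"
    by (simp add: F_def right_diff_distrib)
  then have "F (t + T - e) - F (t + e) = (1 + (- 1) ^ k) / (real k - 1) * (T / T ^ k * lattice_sum (k - 1) (e / T))"
    using W1[of "e / T"] e T by (simp add: mult_ac)
  ultimately show ?thesis by simp
qed

text \<open>The integral found in \<open>scaled_pole_has_integral\<close> is the term to be discarded plus a term that tends to
  \<open>0\<close>: for odd \<open>k\<close> all coefficients vanish, and for even \<open>k\<close> the function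
  \<open>lattice_sum_reg (k - 1)\<close> vanishes at \<open>0\<close>. For \<open>k = 1\<close> both sides are \<open>0\<close>, the divisor \<open>0\<close> being
  accompanied by the factor \<open>1 + (- 1) ^ k = 0\<close>.\<close>

lemma scaled_pole_divergent_part:
  assumes T: "T > 0" and k: "k \<ge> 1" and e: "0 < e"
  shows "(1 + (- 1) ^ k) / (real k - 1) * (T / T ^ k * lattice_sum (k - 1) (e / T))
           = (1 + (- 1) ^ k) * (e powi (1 - int k) / (real k - 1))
             + (1 + (- 1) ^ k) / (real k - 1) * (T / T ^ k) * lattice_sum_reg (k - 1) (e / T)"
proof (cases "odd k")
  case False
  with k obtain j where j: "k = Suc j" "j \<ge> 1" by (cases k; cases "k = 1") auto
  have "T / T ^ k * lattice_sum (k - 1) (e / T) = 1 / e ^ j + T / T ^ k * lattice_sum_reg (k - 1) (e / T)"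
    using j e T by (simp add: lattice_sum_split power_divide distrib_left)
  moreover have "e powi (1 - int k) = 1 / e ^ j"
    by (simp add: j(1) power_int_minus inverse_eq_divide)
  moreover have "x / d * (y + C * R) = x * (y / d) + x / d * C * R" for x d y C R :: real
    by (simp add: distrib_left mult.assoc add_divide_distrib)
  ultimately show ?thesis by metis
qed simp

text \<open>The divergent terms ordered by the order \<open>k = m - i\<close> of the pole; the added term \<open>k = 1\<close> is \<open>0\<close>.\<close>

lemma divergent_part_reindex:
  assumes m: "m \<ge> 1"
  shows "(\<Sum>i<m - 1. (1 + (- 1) powi (int i - int m)) * (d i / fact i)
             * (e powi (int i - int m + 1) / (real m - 1 - real i)))
         = (\<Sum>k=1..m. d (m - k) / fact (m - k) * ((1 + (- 1) ^ k) * (e powi (1 - int k) / (real k - 1))))"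
proof -
  have "(\<Sum>i<m - 1. (1 + (- 1) powi (int i - int m)) * (d i / fact i)
             * (e powi (int i - int m + 1) / (real m - 1 - real i)))
      = (\<Sum>k\<in>{2..m}. d (m - k) / fact (m - k) * ((1 + (- 1) ^ k) * (e powi (1 - int k) / (real k - 1))))"
  proof (rule sum.reindex_bij_witness[of _ "\<lambda>k. m - k" "\<lambda>i. m - i"])
    fix i assume i: "i \<in> {..<m - 1}"
    have "(- 1 :: real) powi (int i - int m) = (- 1) powi (- int (m - i))"
      using i by (simp add: of_nat_diff)
    also have "\<dots> = (- 1) ^ (m - i)"
      by (simp only: power_int_minus power_int_of_nat) (simp add: power_inverse[symmetric])
    finally have sign: "(- 1 :: real) powi (int i - int m) = (- 1) ^ (m - i)" .
    show "d (m - (m - i)) / fact (m - (m - i))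
          * ((1 + (- 1) ^ (m - i)) * (e powi (1 - int (m - i)) / (real (m - i) - 1)))
        = (1 + (- 1) powi (int i - int m)) * (d i / fact i) * (e powi (int i - int m + 1) / (real m - 1 - real i))"
    proof -
      have "m - (m - i) = i" "1 - int (m - i) = int i - int m + 1" "real (m - i) - 1 = real m - 1 - real i"
        using i by (simp_all add: of_nat_diff)
      then show ?thesis unfolding sign by (simp only: mult_ac times_divide_eq_left times_divide_eq_right)
    qed
  qed auto
  also have "\<dots> = (\<Sum>k=1..m. d (m - k) / fact (m - k) * ((1 + (- 1) ^ k) * (e powi (1 - int k) / (real k - 1))))"
    by (rule sum.mono_neutral_left) auto
  finally show ?thesis .
qed

text \<open>Periodicity moves the integral over \<open>[a, t - \<epsilon>]\<close> to \<open>[b, t + T - \<epsilon>]\<close>, so a single integral over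
  \<open>[t + \<epsilon>, t + T - \<epsilon>]\<close> remains, on which the decomposition of \<open>f\<close> is integrated term by term.\<close>

lemma hadamard_fp_eq_integral:
  fixes a b t T :: real and m :: nat and f g u :: "real \<Rightarrow> real"
  defines "c \<equiv> \<lambda>k. (deriv ^^ (m - k)) g t / fact (m - k)"
  assumes ab: "a < t" "t < b" and T: "T = b - a" and m: "m \<ge> 1"
    and f: "continuous_on (punctured_line t T) f"
    and per: "\<And>x. x \<in> punctured_line t T \<Longrightarrow> f (x + T) = f x"
    and u: "continuous_on UNIV u"
    and fu: "\<And>x. x \<in> punctured_line t T \<Longrightarrow> f x = (\<Sum>k=1..m. c k * scaled_pole T t k x) + u x"
  shows "hadamard_fp a b t m g f = integral {t..t + T} u"
proof -
  have T0: "T > 0" using ab T by simp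
  define \<epsilon>0 where "\<epsilon>0 = min (t - a) (b - t)"
  have \<epsilon>0: "\<epsilon>0 > 0" using ab by (simp add: \<epsilon>0_def)
  define U where "U = (\<lambda>x. integral {t..x} u)"
  define q where "q = (\<lambda>k. (1 + (- 1) ^ k) / (real k - 1) * (T / T ^ k))"
  let ?I = "\<lambda>e. integral {a..t - e} f + integral {t + e..b} f
     - (\<Sum>i<m - 1. (1 + (-1) powi (int i - int m)) * ((deriv ^^ i) g t / fact i)
           * (e powi (int i - int m + 1) / (real m - 1 - real i)))"
  have u_int: "u integrable_on {x..y}" for x y
    by (intro integrable_continuous_real continuous_on_subset[OF u]) auto
  have I: "?I e = U (t + T - e) - U (t + e) + (\<Sum>k=1..m. c k * (q k * lattice_sum_reg (k - 1) (e / T)))"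
    if e: "0 < e" "e < \<epsilon>0" for e
  proof -
    have e2: "e < t - a" "e < b - t" "2 * e \<le> T" using e T by (auto simp: \<epsilon>0_def)
    have sub1: "{a..t - e} \<subseteq> punctured_line t T"
      using e e2 T ab by (intro subsetI near_puncture[OF T0]) auto
    have sub2: "{t + e..t + T - e} \<subseteq> punctured_line t T"
      using e e2 T ab by (intro subsetI near_puncture[OF T0]) auto
    have f_int: "f integrable_on {t + e..t + T - e}"
      by (intro integrable_continuous_real continuous_on_subset[OF f] sub2)
    have "integral {a..t - e} f = integral {a..t - e} (f \<circ> (+) T)"
      using sub1 per by (intro integral_cong) (auto simp: add.commute)
    also have "\<dots> = integral {a + T..t - e + T} f"
      by (rule integral_shift_Icc_real)
    also have "{a + T..t - e + T} = {b..t + T - e}" using T by auto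
    finally have "integral {a..t - e} f + integral {t + e..b} f
        = integral {t + e..b} f + integral {b..t + T - e} f"
      by simp
    also have "\<dots> = integral {t + e..t + T - e} f"
      using e e2 T ab f_int by (intro Henstock_Kurzweil_Integration.integral_combine) auto
    also have "\<dots> = (\<Sum>k=1..m. c k * ((1 + (- 1) ^ k) / (real k - 1) * (T / T ^ k * lattice_sum (k - 1) (e / T))))
        + integral {t + e..t + T - e} u"
    proof (rule integral_unique)
      have "((\<lambda>x. (\<Sum>k=1..m. c k * scaled_pole T t k x) + u x) has_integral
          (\<Sum>k=1..m. c k * ((1 + (- 1) ^ k) / (real k - 1) * (T / T ^ k * lattice_sum (k - 1) (e / T))))
          + integral {t + e..t + T - e} u) {t + e..t + T - e}"
        using e e2 T0 u_int
        by (intro has_integral_add has_integral_sum has_integral_mult_right scaled_pole_has_integral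
            integrable_integral) auto
      then show "(f has_integral
          (\<Sum>k=1..m. c k * ((1 + (- 1) ^ k) / (real k - 1) * (T / T ^ k * lattice_sum (k - 1) (e / T))))
          + integral {t + e..t + T - e} u) {t + e..t + T - e}"
        by (rule has_integral_eq[rotated]) (use sub2 fu in auto)
    qed
    also have "(\<Sum>k=1..m. c k * ((1 + (- 1) ^ k) / (real k - 1) * (T / T ^ k * lattice_sum (k - 1) (e / T))))
        = (\<Sum>k=1..m. c k * ((1 + (- 1) ^ k) * (e powi (1 - int k) / (real k - 1))))
          + (\<Sum>k=1..m. c k * (q k * lattice_sum_reg (k - 1) (e / T)))"
      unfolding sum.distrib[symmetric] q_def
      by (intro sum.cong refl) (subst scaled_pole_divergent_part, use T0 e in \<open>auto simp: distrib_left\<close>)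
    also have "integral {t + e..t + T - e} u = U (t + T - e) - U (t + e)"
      unfolding U_def using e e2 T0 u_int
      by (subst Henstock_Kurzweil_Integration.integral_combine[of t "t + e" "t + T - e" u, symmetric]) auto
    finally show ?thesis
      unfolding divergent_part_reindex[OF m] c_def by simp
  qed
  have U_cont: "continuous_on {t..t + T} U"
    unfolding U_def by (intro indefinite_integral_continuous_1 u_int)
  have lattice_sum_reg_lim: "((\<lambda>e. c k * (q k * lattice_sum_reg (k - 1) (e / T))) \<longlongrightarrow> 0) (at_right 0)" if k: "k \<ge> 1" for k
  proof -
    have "isCont (lattice_sum_reg (k - 1)) 0"
      using smooth_on_continuous_on[OF smooth_on_lattice_sum_reg] by (rule continuous_on_interior) simp
    then have "(lattice_sum_reg (k - 1) \<longlongrightarrow> lattice_sum_reg (k - 1) 0) (at 0)"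
      by (simp add: isCont_def)
    moreover have "filterlim (\<lambda>e. e / T) (at 0) (at_right 0)"
    proof -
      have "((\<lambda>e. e / T) \<longlongrightarrow> 0 / T) (at_right 0)" by (intro tendsto_intros) (use T0 in auto)
      then show ?thesis
        unfolding filterlim_at using T0 by (auto simp: eventually_at_filter)
    qed
    ultimately have "((\<lambda>e. lattice_sum_reg (k - 1) (e / T)) \<longlongrightarrow> lattice_sum_reg (k - 1) 0) (at_right 0)"
      by (rule filterlim_compose)
    then have "((\<lambda>e. c k * (q k * lattice_sum_reg (k - 1) (e / T))) \<longlongrightarrow> c k * (q k * lattice_sum_reg (k - 1) 0)) (at_right 0)"
      by (intro tendsto_intros)
    moreover have "q k * lattice_sum_reg (k - 1) 0 = 0"
      using k by (cases "even k") (auto simp: q_def lattice_sum_reg_0)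
    ultimately show ?thesis by (simp only: mult_zero_right)
  qed
  have lim_U: "((\<lambda>e. U (t + T - e)) \<longlongrightarrow> U (t + T)) (at_right 0)"
    "((\<lambda>e. U (t + e)) \<longlongrightarrow> U t) (at_right 0)"
  proof -
    have ev: "\<forall>\<^sub>F e in at_right 0. e \<in> {0<..<T}"
      using eventually_at_right_real[OF T0] .
    show "((\<lambda>e. U (t + T - e)) \<longlongrightarrow> U (t + T)) (at_right 0)"
    proof (rule continuous_on_tendsto_compose[OF U_cont])
      have "((\<lambda>e. t + T - e) \<longlongrightarrow> t + T - 0) (at_right 0)" by (intro tendsto_intros)
      then show "((\<lambda>e. t + T - e) \<longlongrightarrow> t + T) (at_right 0)" by simp
    qed (use ev T0 in \<open>auto elim!: eventually_mono\<close>)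
    show "((\<lambda>e. U (t + e)) \<longlongrightarrow> U t) (at_right 0)"
    proof (rule continuous_on_tendsto_compose[OF U_cont])
      have "((\<lambda>e. t + e) \<longlongrightarrow> t + 0) (at_right 0)" by (intro tendsto_intros)
      then show "((\<lambda>e. t + e) \<longlongrightarrow> t) (at_right 0)" by simp
    qed (use ev T0 in \<open>auto elim!: eventually_mono\<close>)
  qed
  have "((\<lambda>e. U (t + T - e) - U (t + e) + (\<Sum>k=1..m. c k * (q k * lattice_sum_reg (k - 1) (e / T))))
      \<longlongrightarrow> U (t + T) - U t + (\<Sum>k=1..m. 0)) (at_right 0)"
    by (intro tendsto_add tendsto_diff tendsto_sum lim_U lattice_sum_reg_lim) auto
  then have "(?I \<longlongrightarrow> U (t + T) - U t + (\<Sum>k=1..m. 0)) (at_right 0)"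
    by (rule Lim_transform_eventually)
      (use eventually_at_right_real[OF \<epsilon>0] I in \<open>auto elim!: eventually_mono\<close>)
  then have "(?I \<longlongrightarrow> integral {t..t + T} u) (at_right 0)"
    by (simp add: U_def)
  then show ?thesis
    unfolding hadamard_fp_def by (intro tendsto_Lim) auto
qed

section \<open>The punctured trapezoidal sum\<close>

text \<open>An exact identity. In the sum on the right \<open>k\<close> runs over the even orders including \<open>0\<close>: the terms
  with \<open>k \<ge> 2\<close> come from the poles, and the term with \<open>k = 0\<close> is what the missing node \<open>j = 0\<close> leaves
  after the constant contributions of the poles have cancelled.\<close>

lemma punctured_trapezoidal_eq:
  fixes t T :: real and m :: nat and f u :: "real \<Rightarrow> real" and c :: "nat \<Rightarrow> real"
  assumes T: "T > 0" and n: "n \<ge> 1"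
    and fu: "\<And>x. x \<in> punctured_line t T \<Longrightarrow> f x = (\<Sum>k=1..m. c k * scaled_pole T t k x) + u x"
    and ut: "u t = c 0 - (\<Sum>k=1..m. c k * (lattice_sum_reg k 0 / T ^ k))"
  shows "punctured_trapezoidal T t n f = T / real n * (\<Sum>j<n. u (t + real j * (T / real n)))
    + 2 * (\<Sum>k\<in>{k. k \<le> m \<and> even k}. c k * Re (zeta (of_nat k)) * (T / real n) powi (1 - int k))"
proof -
  define h where "h = T / real n"
  have h: "h > 0" using T n by (simp add: h_def)
  let ?Z = "\<lambda>k. if even k then 2 * Re (zeta (of_nat k)) else 0"
  have f: "f (t + real j * h) = (\<Sum>k=1..m. c k / T ^ k * lattice_sum k (real j / real n)) + u (t + real j * h)"
    if j: "j \<in> {1..<n}" for j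
  proof -
    have jn: "real j * h / T = real j / real n" using T by (simp add: h_def)
    have "t + real j * h \<in> punctured_line t T"
    proof (rule near_puncture[OF T])
      have "real j * h < real n * h" using j h by simp
      also have "\<dots> = T" using n by (simp add: h_def)
      finally show "\<bar>t + real j * h - t\<bar> < T" using h by simp
    qed (use j h in auto)
    then show ?thesis by (simp add: fu scaled_pole_def jn)
  qed
  have lattice_sum_reg0: "lattice_sum_reg k 0 = ?Z k" if "k \<ge> 1" for k
    using that half_lattice_sum_1[of k] by (cases "k = 1") (auto simp: lattice_sum_reg_0)
  have "punctured_trapezoidal T t n f = h * (\<Sum>j=1..<n. f (t + real j * h))"
    by (simp add: punctured_trapezoidal_def h_def)
  also have "(\<Sum>j=1..<n. f (t + real j * h))
      = (\<Sum>j=1..<n. (\<Sum>k=1..m. c k / T ^ k * lattice_sum k (real j / real n)) + u (t + real j * h))"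
    by (intro sum.cong refl f)
  also have "\<dots> = (\<Sum>k=1..m. c k / T ^ k * (\<Sum>j=1..<n. lattice_sum k (real j / real n)))
      + (\<Sum>j=1..<n. u (t + real j * h))"
    unfolding sum.distrib sum_distrib_left by (subst sum.swap) simp
  also have "(\<Sum>k=1..m. c k / T ^ k * (\<Sum>j=1..<n. lattice_sum k (real j / real n)))
      = (\<Sum>k=1..m. c k / T ^ k * ((real n ^ k - 1) * ?Z k))"
    using n by (intro sum.cong refl) (subst sum_lattice_sum, auto)
  also have "(\<Sum>j=1..<n. u (t + real j * h)) = (\<Sum>j<n. u (t + real j * h)) - u t"
  proof -
    have "{..<n} = insert 0 {1..<n}" using n by auto
    then show ?thesis by simp
  qed
  finally have "punctured_trapezoidal T t n f = h * (\<Sum>j<n. u (t + real j * h))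
      + (h * (\<Sum>k=1..m. c k / T ^ k * ((real n ^ k - 1) * ?Z k)) - h * u t)"
    by (simp add: algebra_simps)
  also have "h * (\<Sum>k=1..m. c k / T ^ k * ((real n ^ k - 1) * ?Z k)) - h * u t
      = h * (\<Sum>k=1..m. c k / T ^ k * (real n ^ k * ?Z k)) - h * c 0"
  proof -
    have "(\<Sum>k=1..m. c k / T ^ k * ((real n ^ k - 1) * ?Z k))
        = (\<Sum>k=1..m. c k / T ^ k * (real n ^ k * ?Z k)) - (\<Sum>k=1..m. c k * (lattice_sum_reg k 0 / T ^ k))"
      unfolding sum_subtractf[symmetric]
      by (intro sum.cong refl) (simp add: lattice_sum_reg0 left_diff_distrib right_diff_distrib)
    then show ?thesis unfolding ut by algebra
  qed
  also have "\<dots> = (\<Sum>k\<le>m. c k * ?Z k * h powi (1 - int k))"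
  proof -
    have "h * (c k / T ^ k * (real n ^ k * ?Z k)) = c k * ?Z k * h powi (1 - int k)" for k
      using h T n by (simp add: power_int_diff h_def power_divide field_simps)
    moreover have "{..m} = insert 0 {1..m}" by auto
    ultimately show ?thesis by (simp add: sum_distrib_left zeta_0)
  qed
  also have "\<dots> = 2 * (\<Sum>k\<in>{k. k \<le> m \<and> even k}. c k * Re (zeta (of_nat k)) * h powi (1 - int k))"
    unfolding sum_distrib_left by (rule sum.mono_neutral_cong_right) auto
  finally show ?thesis by (simp add: h_def)
qed

text \<open>Even and odd \<open>m\<close> at once: the sum is indexed by the argument \<open>k\<close> of \<open>zeta\<close>, which is even in either
  case.\<close>

lemma periodic_singular_trapezoidal_asymptotics:
  fixes a b t T :: real and m :: nat and f g :: "real \<Rightarrow> real" and h :: "nat \<Rightarrow> real"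
  assumes ab: "a < t" "t < b" and T: "T = b - a" and m: "m \<ge> 1"
    and g: "smooth_on {a..b} g"
    and f: "smooth_on (punctured_line t T) f"
    and per: "\<And>x. x \<in> punctured_line t T \<Longrightarrow> f (x + T) = f x"
    and fg: "\<And>x. x \<in> {a..b} - {t} \<Longrightarrow> f x = g x / (x - t) ^ m"
    and h: "\<And>n. h n = T / real n"
    and \<mu>: "\<mu> > 0"
  shows "(\<lambda>n. punctured_trapezoidal T t n f
             - (hadamard_fp a b t m g f
                + 2 * (\<Sum>k\<in>{k. k \<le> m \<and> even k}. (deriv ^^ (m - k)) g t / fact (m - k)
                      * Re (zeta (of_nat k)) * h n powi (1 - int k))))
           \<in> o(\<lambda>n. h n powr \<mu>)"
proof -
  have T0: "T > 0" using ab T by simp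
  define c where "c = (\<lambda>k. (deriv ^^ (m - k)) g t / fact (m - k))"
  obtain u where u: "smooth_on UNIV u" and u_per: "\<And>x. u (x + T) = u x"
    and fu: "\<And>x. x \<in> punctured_line t T \<Longrightarrow> f x = (\<Sum>k=1..m. c k * scaled_pole T t k x) + u x"
    and ut: "u t = c 0 - (\<Sum>k=1..m. c k * (lattice_sum_reg k 0 / T ^ k))"
    using subtract_singular_part[OF ab T g f per fg] unfolding c_def by blast
  have fp: "hadamard_fp a b t m g f = integral {t..t + T} u"
    using hadamard_fp_eq_integral[OF ab T m smooth_on_continuous_on[OF f] per
        smooth_on_continuous_on[OF u] fu[unfolded c_def]] .
  \<comment> \<open>an order strictly above \<open>\<mu>\<close> turns \<open>O(h ^ N)\<close> into \<open>o(h powr \<mu>)\<close>\<close>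
  define N where "N = nat \<lceil>\<mu>\<rceil> + 1"
  have N: "N \<ge> 1" "real N > \<mu>" unfolding N_def by linarith+
  obtain C where C: "\<And>n. n \<ge> 1 \<Longrightarrow>
      \<bar>T / real n * (\<Sum>j<n. u (t + real j * (T / real n))) - integral {t..t+T} u\<bar> \<le> C * (T / real n) ^ N"
    using trapezoidal_periodic[OF T0 u u_per N(1)] by blast
  let ?E = "\<lambda>n. punctured_trapezoidal T t n f
     - (hadamard_fp a b t m g f
        + 2 * (\<Sum>k\<in>{k. k \<le> m \<and> even k}. c k * Re (zeta (of_nat k)) * h n powi (1 - int k)))"
  have "?E \<in> O(\<lambda>n. h n ^ N)"
  proof (rule bigoI[of _ C])
    show "\<forall>\<^sub>F n in sequentially. norm (?E n) \<le> C * norm (h n ^ N)"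
      using eventually_ge_at_top[of 1]
    proof eventually_elim
      case (elim n)
      have "?E n = T / real n * (\<Sum>j<n. u (t + real j * (T / real n))) - integral {t..t+T} u"
        using punctured_trapezoidal_eq[where f = f and u = u and c = c and m = m, OF T0 elim fu ut]
        by (simp only: fp h)
      then show ?case using C[OF elim] T0 by (simp add: h)
    qed
  qed
  also have "(\<lambda>n. h n ^ N) \<in> o(\<lambda>n. h n powr \<mu>)"
  proof (rule smalloI_tendsto)
    have "h \<longlonglongrightarrow> 0"
      unfolding h[abs_def]
      by (rule real_tendsto_divide_at_top[OF tendsto_const filterlim_real_sequentially])
    then have "(\<lambda>n. h n powr (real N - \<mu>)) \<longlonglongrightarrow> 0"
      by (rule tendsto_zero_powrI[OF _ tendsto_const]) (use N T0 in \<open>simp_all add: h\<close>)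
    moreover have "\<forall>\<^sub>F n in sequentially. h n powr (real N - \<mu>) = h n ^ N / h n powr \<mu>"
      using eventually_ge_at_top[of 1]
      by eventually_elim (use T0 in \<open>simp add: h powr_diff powr_realpow\<close>)
    ultimately show "(\<lambda>n. h n ^ N / h n powr \<mu>) \<longlonglongrightarrow> 0"
      by (rule Lim_transform_eventually)
    show "\<forall>\<^sub>F n in sequentially. h n powr \<mu> \<noteq> 0"
      using eventually_ge_at_top[of 1] by eventually_elim (use T0 in \<open>simp add: h\<close>)
  qed
  finally show ?thesis unfolding c_def .
qed

lemma even_index_sum:
  fixes d :: "nat \<Rightarrow> real"
  assumes "m = 2 * r \<or> m = 2 * r + 1"
  shows "(\<Sum>i=0..r. d (m - 2 * (r - i)) / fact (m - 2 * (r - i)) * Re (zeta (of_nat (2 * r - 2 * i)))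
             * x powi (- 2 * int r + 2 * int i + 1))
       = (\<Sum>k\<in>{k. k \<le> m \<and> even k}. d (m - k) / fact (m - k) * Re (zeta (of_nat k)) * x powi (1 - int k))"
proof (rule sum.reindex_bij_witness[of _ "\<lambda>k. r - k div 2" "\<lambda>i. 2 * (r - i)"])
  fix i assume "i \<in> {0..r}"
  then have "2 * r - 2 * i = 2 * (r - i)" "1 - int (2 * (r - i)) = - 2 * int r + 2 * int i + 1"
    by (auto simp: of_nat_diff)
  then show "d (m - 2 * (r - i)) / fact (m - 2 * (r - i)) * Re (zeta (of_nat (2 * (r - i)))) * x powi (1 - int (2 * (r - i)))
      = d (m - 2 * (r - i)) / fact (m - 2 * (r - i)) * Re (zeta (of_nat (2 * r - 2 * i)))
        * x powi (- 2 * int r + 2 * int i + 1)"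
    by (simp only:)
qed (use assms in auto)

theorem theorem3p1:
  fixes a b t T :: real and m :: nat and f g :: "real \<Rightarrow> real" and h :: "nat \<Rightarrow> real"
  assumes "a < t" and "t < b" and "T = b - a" and "m \<ge> 1"
    and "smooth_on {a..b} g"
    and "smooth_on (punctured_line t T) f"
    and "\<And>x. x \<in> punctured_line t T \<Longrightarrow> f (x + T) = f x"
    and "\<And>x. x \<in> {a..b} - {t} \<Longrightarrow> f x = g x / (x - t) ^ m"
    and "\<And>n. h n = T / real n"
  shows "(\<forall>r. m = 2 * r \<longrightarrow> (\<forall>\<mu>>0.
            (\<lambda>n. punctured_trapezoidal T t n f
               - (hadamard_fp a b t m g f
                  + 2 * (\<Sum>i = 0..r. (deriv ^^ (2 * i)) g t / fact (2 * i)
                        * Re (zeta (of_nat (2 * r - 2 * i)))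
                        * h n powi (- 2 * int r + 2 * int i + 1))))
            \<in> o(\<lambda>n. h n powr \<mu>)))
       \<and> (\<forall>r. m = 2 * r + 1 \<longrightarrow> (\<forall>\<mu>>0.
            (\<lambda>n. punctured_trapezoidal T t n f
               - (hadamard_fp a b t m g f
                  + 2 * (\<Sum>i = 0..r. (deriv ^^ (2 * i + 1)) g t / fact (2 * i + 1)
                        * Re (zeta (of_nat (2 * r - 2 * i)))
                        * h n powi (- 2 * int r + 2 * int i + 1))))
            \<in> o(\<lambda>n. h n powr \<mu>)))"
proof -
  have *: "(\<lambda>n. punctured_trapezoidal T t n f
               - (hadamard_fp a b t m g f
                  + 2 * (\<Sum>i = 0..r. (deriv ^^ e i) g t / fact (e i)
                        * Re (zeta (of_nat (2 * r - 2 * i)))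
                        * h n powi (- 2 * int r + 2 * int i + 1))))
            \<in> o(\<lambda>n. h n powr \<mu>)"
    if m: "m = 2 * r \<or> m = 2 * r + 1" and e: "\<And>i. i \<le> r \<Longrightarrow> e i = m - 2 * (r - i)" and "\<mu> > 0"
    for r e \<mu>
  proof -
    have "(\<Sum>i = 0..r. (deriv ^^ e i) g t / fact (e i) * Re (zeta (of_nat (2 * r - 2 * i)))
            * h n powi (- 2 * int r + 2 * int i + 1))
        = (\<Sum>k\<in>{k. k \<le> m \<and> even k}. (deriv ^^ (m - k)) g t / fact (m - k)
            * Re (zeta (of_nat k)) * h n powi (1 - int k))" for n
      unfolding even_index_sum[OF m, of "\<lambda>k. (deriv ^^ k) g t", symmetric]
      by (intro sum.cong refl) (simp add: e)
    then show ?thesis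
      using periodic_singular_trapezoidal_asymptotics[OF assms \<open>\<mu> > 0\<close>] by (simp only:)
  qed
  show ?thesis
    by (intro conjI allI impI *) auto
qed

end
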